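(* Let $G=G_{20}\cong G_{18}^{\,4}$ be the group presented by generators $a,b,c$ and relations $a^2=b^2=c^2=1$, $(abc)^2=1$, $(ab)^3=(ac)^3=1$, and let $H$ be the group with elements $z_{12}^{\beta}\xi_1^{\gamma_1}\xi_2^{\gamma_2}w^{\sigma}$ defined in the context. Then the cyclic subgroup $Z_{12}:=\langle z_{12}\rangle$ is equal to the center $Z(H)$ of $H$ and is isomorphic to the Schur multiplier $M(G)$. Moreover $$M(G)\cong Z(H)\subset Z(H)\cap[H,H],\qquad H/Z(H)\cong G,$$ so that $H$ is a representation group $R(G)$ of $G$. With $\Xi_i:=\langle\xi_i\rangle$ $(i=1,2)$ and $W:=\langle w\rangle$, its structure is $$R(G_{20})=H=\big[(\Xi_1\times Z_{12})\rtimes\Xi_2\big]\rtimes W\cong\big[(C_3\times C_3)\rtimes C_3\big]\rtimes C_2,$$ and its GAP identity is $[54,5]$ or $[54,8]$.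
   Context: $H$ is the group generated by $\xi_1,\xi_2,z_{12},w$ with relations $$\xi_1^3=\xi_2^3=1,\quad z_{12}^3=1,\quad w^2=1,\quad z_{12}\ \text{central},\quad \xi_2\xi_1=z_{12}^{-1}\xi_1\xi_2,\quad w\xi_iw^{-1}=\xi_i^{-1}\ (i=1,2).$$ Its elements are $z_{12}^{\beta}\xi_1^{\gamma_1}\xi_2^{\gamma_2}w^{\sigma}=:(\beta,\gamma_1,\gamma_2,\sigma)$, $0\le\beta,\gamma_1,\gamma_2\le2$ (mod 3), $0\le\sigma\le1$ (mod 2), with product $(\beta,\gamma_1,\gamma_2,\sigma)(\beta',\gamma_1',\gamma_2',\sigma')=(\beta'',\gamma_1'',\gamma_2'',\sigma'')$, where $\beta''=\beta+\beta'-\gamma_2(-1)^\sigma\gamma_1'$, $\gamma_i''=\gamma_i+(-1)^\sigma\gamma_i'$ (mod 3, $i=1,2$), $\sigma''=\sigma+\sigma'$ (mod 2). The covering map $\delta:H\to G$ is $\xi_1\mapsto x_1:=ab$, $\xi_2\mapsto x_2:=ca$, $w\mapsto a$, $z_{12}=[\xi_1,\xi_2]\mapsto[x_1,x_2]=1$. Conventions: $[x,y]=xyx^{-1}y^{-1}$; $M(G)=H^2(G,\mathbb{C}^\times)$ (trivial action) is the Schur multiplier; $C_k$ is the cyclic group of order $k$; $G_n^{\,k}$ denotes the group with GAP identity $[n,k]$, i.e. SmallGroup$(n,k)$ of the GAP Small Groups library. A group $H$ is a representation group of $G$ if it has a subgroup $A\subset Z(H)\cap[H,H]$ with $A\cong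 M(G)$ and $H/A\cong G$. *)

theory Defs
  imports Complex_Main "HOL-Algebra.Bij" "HOL-Algebra.Generated_Groups" "HOL-Algebra.Elementary_Groups"
begin

section \<open>Groups given by generators and relations\<close>

text \<open>
  The generators are all elements of the type \<open>'g\<close>; the letter \<open>(g, True)\<close> stands for \<open>g\<close> and
  \<open>(g, False)\<close> for its inverse. A relation \<open>u = v\<close> is given as the pair \<open>(u, v)\<close>. The presented
  group is the set of words modulo the least congruence that identifies the two sides of every
  relation and cancels adjacent inverse letters, i.e. the free group modulo the normal closure of
  the relators.
\<close>

type_synonym 'g word = "('g \<times> bool) list"

definition letter :: "'g \<Rightarrow> 'g word" where
  "letter g = [(g, True)]"

definition word_inv :: "'g word \<Rightarrow> 'g word" where
  "word_inv u = rev (map (\<lambda>(g, b). (g, \<not> b)) u)"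

definition word_pow :: "'g word \<Rightarrow> nat \<Rightarrow> 'g word" where
  "word_pow u n = concat (replicate n u)"

inductive pres_eq :: "('g word \<times> 'g word) set \<Rightarrow> 'g word \<Rightarrow> 'g word \<Rightarrow> bool"
  for R where
  pres_refl: "pres_eq R u u"
| pres_sym: "pres_eq R u v \<Longrightarrow> pres_eq R v u"
| pres_trans: "pres_eq R u v \<Longrightarrow> pres_eq R v w \<Longrightarrow> pres_eq R u w"
| pres_append: "pres_eq R u u' \<Longrightarrow> pres_eq R v v' \<Longrightarrow> pres_eq R (u @ v) (u' @ v')"
| pres_cancel: "pres_eq R [(g, b), (g, \<not> b)] []"
| pres_relation: "(u, v) \<in> R \<Longrightarrow> pres_eq R u v"

definition word_class :: "('g word \<times> 'g word) set \<Rightarrow> 'g word \<Rightarrow> 'g word set" where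
  "word_class R u = {v. pres_eq R u v}"

definition presented_group :: "('g word \<times> 'g word) set \<Rightarrow> 'g word set monoid" where
  "presented_group R =
     \<lparr>carrier = range (word_class R),
      mult = (\<lambda>U V. \<Union>u\<in>U. \<Union>v\<in>V. word_class R (u @ v)),
      one = word_class R []\<rparr>"


section \<open>Centre, Schur multiplier, representation groups\<close>

definition center :: "('a, 'm) monoid_scheme \<Rightarrow> 'a set" where
  "center G = {z \<in> carrier G. \<forall>x\<in>carrier G. z \<otimes>\<^bsub>G\<^esub> x = x \<otimes>\<^bsub>G\<^esub> z}"

text \<open>2-cocycles and 2-coboundaries of \<open>G\<close> with values in the trivial module
  \<open>\<complex>\<^sup>\<times> = - {0}\<close>, written multiplicatively.\<close>

definition cocycles2 :: "('a, 'm) monoid_scheme \<Rightarrow> ('a \<times> 'a \<Rightarrow> complex) monoid" where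
  "cocycles2 G =
     \<lparr>carrier = {f \<in> carrier G \<times> carrier G \<rightarrow>\<^sub>E - {0}.
         \<forall>x\<in>carrier G. \<forall>y\<in>carrier G. \<forall>z\<in>carrier G.
           f (y, z) * f (x, y \<otimes>\<^bsub>G\<^esub> z) = f (x \<otimes>\<^bsub>G\<^esub> y, z) * f (x, y)},
      mult = (\<lambda>f g. \<lambda>p\<in>carrier G \<times> carrier G. f p * g p),
      one = (\<lambda>p\<in>carrier G \<times> carrier G. 1)\<rparr>"

definition coboundaries2 :: "('a, 'm) monoid_scheme \<Rightarrow> ('a \<times> 'a \<Rightarrow> complex) set" where
  "coboundaries2 G =
     (\<lambda>c. \<lambda>(x, y)\<in>carrier G \<times> carrier G. c x * c y / c (x \<otimes>\<^bsub>G\<^esub> y)) ` (carrier G \<rightarrow> - {0})"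

definition schur_multiplier :: "('a, 'm) monoid_scheme \<Rightarrow> ('a \<times> 'a \<Rightarrow> complex) set monoid" where
  "schur_multiplier G = cocycles2 G Mod coboundaries2 G"

definition representation_group ::
    "('a, 'm) monoid_scheme \<Rightarrow> ('b, 'n) monoid_scheme \<Rightarrow> bool" where
  "representation_group H G \<longleftrightarrow>
     group H \<and>
     (\<exists>A. subgroup A H \<and> A \<subseteq> center H \<inter> derived H (carrier H) \<and>
          H\<lparr>carrier := A\<rparr> \<cong> schur_multiplier G \<and> H Mod A \<cong> G)"


section \<open>Direct and semidirect products\<close>

text \<open>Internal: the subgroup \<open>S\<close> of \<open>G\<close> is \<open>N \<rtimes> K\<close>, respectively \<open>N \<times> K\<close>.\<close>

definition internal_semidirect ::
    "('a, 'm) monoid_scheme \<Rightarrow> 'a set \<Rightarrow> 'a set \<Rightarrow> 'a set \<Rightarrow> bool" where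
  "internal_semidirect G N K S \<longleftrightarrow>
     subgroup S G \<and> N \<lhd> G\<lparr>carrier := S\<rparr> \<and> subgroup K (G\<lparr>carrier := S\<rparr>) \<and>
     N \<inter> K = {\<one>\<^bsub>G\<^esub>} \<and> S = N <#>\<^bsub>G\<^esub> K"

definition internal_direct ::
    "('a, 'm) monoid_scheme \<Rightarrow> 'a set \<Rightarrow> 'a set \<Rightarrow> 'a set \<Rightarrow> bool" where
  "internal_direct G N K S \<longleftrightarrow> internal_semidirect G N K S \<and> K \<lhd> G\<lparr>carrier := S\<rparr>"

text \<open>External: \<open>N \<rtimes>\<^sub>\<phi> K\<close> for an action \<open>\<phi> \<in> hom K (AutoGroup N)\<close>.\<close>

definition semidirect_product ::
    "('a, 'm) monoid_scheme \<Rightarrow> ('b, 'n) monoid_scheme \<Rightarrow> ('b \<Rightarrow> 'a \<Rightarrow> 'a) \<Rightarrow> ('a \<times> 'b) monoid" where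
  "semidirect_product N K \<phi> =
     \<lparr>carrier = carrier N \<times> carrier K,
      mult = (\<lambda>(n, k) (n', k'). (n \<otimes>\<^bsub>N\<^esub> \<phi> k n', k \<otimes>\<^bsub>K\<^esub> k')),
      one = (\<one>\<^bsub>N\<^esub>, \<one>\<^bsub>K\<^esub>)\<rparr>"


section \<open>The groups \<open>G\<^sub>2\<^sub>0\<close> and \<open>H\<close>\<close>

datatype gen20 = A20 | B20 | C20

definition G20 :: "gen20 word set monoid" where
  "G20 = (let a = letter A20; b = letter B20; c = letter C20 in
     presented_group
      {(word_pow a 2, []), (word_pow b 2, []), (word_pow c 2, []),
       (word_pow (a @ b @ c) 2, []), (word_pow (a @ b) 3, []), (word_pow (a @ c) 3, [])})"

datatype genH = GXi1 | GXi2 | GZ12 | GW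

definition relsH :: "(genH word \<times> genH word) set" where
  "relsH = (let x1 = letter GXi1; x2 = letter GXi2; z = letter GZ12; w = letter GW in
      {(word_pow x1 3, []), (word_pow x2 3, []), (word_pow z 3, []), (word_pow w 2, []),
       (z @ x1, x1 @ z), (z @ x2, x2 @ z), (z @ w, w @ z),
       (x2 @ x1, word_inv z @ x1 @ x2),
       (w @ x1 @ word_inv w, word_inv x1), (w @ x2 @ word_inv w, word_inv x2)})"

definition H20 :: "genH word set monoid" where
  "H20 = presented_group relsH"

definition \<xi>\<^sub>1 :: "genH word set" where "\<xi>\<^sub>1 = word_class relsH (letter GXi1)"
definition \<xi>\<^sub>2 :: "genH word set" where "\<xi>\<^sub>2 = word_class relsH (letter GXi2)"
definition z\<^sub>1\<^sub>2 :: "genH word set" where "z\<^sub>1\<^sub>2 = word_class relsH (letter GZ12)"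
definition w\<^sub>H :: "genH word set" where "w\<^sub>H = word_class relsH (letter GW)"

definition \<Xi>\<^sub>1 :: "genH word set set" where "\<Xi>\<^sub>1 = generate H20 {\<xi>\<^sub>1}"
definition \<Xi>\<^sub>2 :: "genH word set set" where "\<Xi>\<^sub>2 = generate H20 {\<xi>\<^sub>2}"
definition Z\<^sub>1\<^sub>2 :: "genH word set set" where "Z\<^sub>1\<^sub>2 = generate H20 {z\<^sub>1\<^sub>2}"
definition W\<^sub>H :: "genH word set set" where "W\<^sub>H = generate H20 {w\<^sub>H}"


section \<open>Groups from the GAP Small Groups library\<close>

text \<open>
  Up to isomorphism, the catalogue groups with identities \<open>[18,4]\<close>, \<open>[54,5]\<close> and \<open>[54,8]\<close>, by
  power-conjugate presentations. \<open>[18,4]\<close> is the generalized dihedral group of \<open>C\<^sub>3 \<times> C\<^sub>3\<close>. The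
  other two are semidirect products of the Heisenberg group \<open>\<langle>f\<^sub>2, f\<^sub>3, f\<^sub>4\<rangle>\<close> of order 27
  and exponent 3 (with centre \<open>\<langle>f\<^sub>4\<rangle>\<close>) with an involution \<open>f\<^sub>1\<close>: in \<open>[54,5]\<close> it inverts \<open>f\<^sub>4\<close>, so
  the centre of the group is trivial; in \<open>[54,8]\<close>, the group known as \<open>\<Delta>(54)\<close>, it acts as
  inversion modulo \<open>\<langle>f\<^sub>4\<rangle>\<close> and centralizes \<open>f\<^sub>4\<close>.
\<close>

datatype pc3 = P1 | P2 | P3
datatype pc4 = F1 | F2 | F3 | F4

definition SmallGroup_18_4 :: "pc3 word set monoid" where
  "SmallGroup_18_4 = (let f1 = letter P1; f2 = letter P2; f3 = letter P3 in
     presented_group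
      {(word_pow f1 2, []), (word_pow f2 3, []), (word_pow f3 3, []),
       (word_inv f1 @ f2 @ f1, word_pow f2 2),
       (word_inv f1 @ f3 @ f1, word_pow f3 2),
       (word_inv f2 @ f3 @ f2, f3)})"

definition SmallGroup_54_5 :: "pc4 word set monoid" where
  "SmallGroup_54_5 = (let f1 = letter F1; f2 = letter F2; f3 = letter F3; f4 = letter F4 in
     presented_group
      {(word_pow f1 2, []), (word_pow f2 3, []), (word_pow f3 3, []), (word_pow f4 3, []),
       (word_inv f1 @ f2 @ f1, f2),
       (word_inv f1 @ f3 @ f1, word_pow f3 2),
       (word_inv f1 @ f4 @ f1, word_pow f4 2),
       (word_inv f2 @ f3 @ f2, f3 @ f4),
       (word_inv f2 @ f4 @ f2, f4),
       (word_inv f3 @ f4 @ f3, f4)})"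

definition SmallGroup_54_8 :: "pc4 word set monoid" where
  "SmallGroup_54_8 = (let f1 = letter F1; f2 = letter F2; f3 = letter F3; f4 = letter F4 in
     presented_group
      {(word_pow f1 2, []), (word_pow f2 3, []), (word_pow f3 3, []), (word_pow f4 3, []),
       (word_inv f1 @ f2 @ f1, word_pow f2 2),
       (word_inv f1 @ f3 @ f1, word_pow f3 2),
       (word_inv f1 @ f4 @ f1, f4),
       (word_inv f2 @ f3 @ f2, f3 @ f4),
       (word_inv f2 @ f4 @ f2, f4),
       (word_inv f3 @ f4 @ f3, f4)})"


section \<open>Presented groups are groups; normal forms in \<open>H20\<close>\<close>

lemma word_class_eq_iff: "word_class R u = word_class R v \<longleftrightarrow> pres_eq R u v"
proof
  assume "word_class R u = word_class R v"
  then have "v \<in> word_class R u" by (simp add: word_class_def pres_refl)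
  then show "pres_eq R u v" by (simp add: word_class_def)
next
  assume "pres_eq R u v"
  then have "pres_eq R u w \<longleftrightarrow> pres_eq R v w" for w
    by (meson pres_sym pres_trans)
  then show "word_class R u = word_class R v" by (simp add: word_class_def)
qed

lemma carrier_presented: "carrier (presented_group R) = range (word_class R)"
  and one_presented: "\<one>\<^bsub>presented_group R\<^esub> = word_class R []"
  by (simp_all add: presented_group_def)

lemma mult_presented:
  "word_class R u \<otimes>\<^bsub>presented_group R\<^esub> word_class R v = word_class R (u @ v)"
proof -
  have "word_class R (u' @ v') = word_class R (u @ v)"
    if "u' \<in> word_class R u" "v' \<in> word_class R v" for u' v'
  proof -
    from that have "pres_eq R (u @ v) (u' @ v')"
      unfolding word_class_def mem_Collect_eq by (rule pres_append)
    then show ?thesis by (simp add: word_class_eq_iff pres_sym)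
  qed
  moreover have "u \<in> word_class R u" "v \<in> word_class R v"
    by (auto simp: word_class_def intro: pres_refl)
  ultimately have "(\<Union>u'\<in>word_class R u. \<Union>v'\<in>word_class R v. word_class R (u' @ v')) =
      word_class R (u @ v)" by blast
  then show ?thesis by (simp add: presented_group_def)
qed

lemma pres_eq_word_inv: "pres_eq R (word_inv u @ u) []"
proof (induction u)
  case Nil
  show ?case by (simp add: word_inv_def pres_refl)
next
  case (Cons l u)
  obtain g b where l: "l = (g, b)" by fastforce
  have "pres_eq R ([(g, \<not> b)] @ [(g, b)]) []"
    using pres_cancel[of R g "\<not> b"] by simp
  then have "pres_eq R (([(g, \<not> b)] @ [(g, b)]) @ u) ([] @ u)"
    by (rule pres_append) (rule pres_refl)
  then have "pres_eq R (word_inv u @ (([(g, \<not> b)] @ [(g, b)]) @ u)) (word_inv u @ ([] @ u))"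
    by (rule pres_append[OF pres_refl])
  from pres_trans[OF this, unfolded append_Nil, OF Cons.IH]
  have "pres_eq R (word_inv u @ ([(g, \<not> b)] @ [(g, b)]) @ u) []" .
  then show ?case by (simp add: word_inv_def l)
qed

lemma group_presented_group: "group (presented_group R)"
proof (rule groupI)
  fix x assume "x \<in> carrier (presented_group R)"
  then obtain u where "x = word_class R u" by (auto simp: carrier_presented)
  then show "\<exists>y\<in>carrier (presented_group R). y \<otimes>\<^bsub>presented_group R\<^esub> x = \<one>\<^bsub>presented_group R\<^esub>"
    by (intro bexI[of _ "word_class R (word_inv u)"])
       (auto simp: mult_presented one_presented carrier_presented word_class_eq_iff pres_eq_word_inv)
qed (auto simp: carrier_presented mult_presented one_presented)

lemma (in group) commute_int_pow:
  assumes [simp]: "x \<in> carrier G" "y \<in> carrier G" "u \<in> carrier G" and eq: "y \<otimes> x = u \<otimes> y"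
  shows "y \<otimes> x [^] (n::int) = u [^] n \<otimes> y"
proof -
  have nat: "y \<otimes> x [^] k = u [^] k \<otimes> y" for k :: nat
  proof (induction k)
    case (Suc k)
    have "y \<otimes> x [^] Suc k = u [^] k \<otimes> (y \<otimes> x)"
      using Suc by (simp add: m_assoc[symmetric])
    then show ?case by (simp add: eq m_assoc)
  qed simp
  show ?thesis
  proof (cases "n < 0")
    case True
    let ?a = "x [^] nat (- n)" and ?b = "u [^] nat (- n)"
    have [simp]: "?a \<in> carrier G" "?b \<in> carrier G" by simp_all
    have "?b \<otimes> (y \<otimes> inv ?a) = y \<otimes> ?a \<otimes> inv ?a"
      unfolding nat by (rule m_assoc[symmetric]) simp_all
    also have "\<dots> = y" by (simp add: m_assoc)
    finally have "inv ?b \<otimes> y = inv ?b \<otimes> (?b \<otimes> (y \<otimes> inv ?a))" by (rule arg_cong[OF sym])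
    also have "\<dots> = (inv ?b \<otimes> ?b) \<otimes> (y \<otimes> inv ?a)" by (rule m_assoc[symmetric]) simp_all
    also have "\<dots> = y \<otimes> inv ?a" by (subst l_inv) simp_all
    finally have "y \<otimes> inv ?a = inv ?b \<otimes> y" by (rule sym)
    then show ?thesis unfolding int_pow_def2 using True by (simp only: if_True)
  next
    case False
    then show ?thesis unfolding int_pow_def2 by (simp only: if_False nat)
  qed
qed

lemma (in group) int_pow_mod:
  assumes "x \<in> carrier G" "x [^] (k::nat) = \<one>"
  shows "x [^] (n mod int k) = x [^] (n::int)"
proof -
  have "x [^] n = x [^] (int k * (n div int k) + n mod int k)" by simp
  also have "\<dots> = (x [^] int k) [^] (n div int k) \<otimes> x [^] (n mod int k)"
    using assms(1) by (simp only: int_pow_mult int_pow_pow)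
  also have "\<dots> = x [^] (n mod int k)" using assms by (simp add: int_pow_int)
  finally show ?thesis by simp
qed

context
begin

interpretation H: group H20
  unfolding H20_def by (rule group_presented_group)

lemma gensH_carrier [simp]:
  "\<xi>\<^sub>1 \<in> carrier H20" "\<xi>\<^sub>2 \<in> carrier H20" "z\<^sub>1\<^sub>2 \<in> carrier H20" "w\<^sub>H \<in> carrier H20"
  by (simp_all add: \<xi>\<^sub>1_def \<xi>\<^sub>2_def z\<^sub>1\<^sub>2_def w\<^sub>H_def H20_def carrier_presented)

lemma word_class_carrier [simp]: "word_class relsH u \<in> carrier H20"
  unfolding H20_def carrier_presented by (rule rangeI)

lemma mult_H: "word_class relsH u \<otimes>\<^bsub>H20\<^esub> word_class relsH v = word_class relsH (u @ v)"
  by (simp add: H20_def mult_presented)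

lemma one_H: "\<one>\<^bsub>H20\<^esub> = word_class relsH []"
  by (simp add: H20_def one_presented)

lemma inv_H: "inv\<^bsub>H20\<^esub> (word_class relsH u) = word_class relsH (word_inv u)"
  by (rule H.inv_equality)
     (simp_all only: mult_H one_H word_class_eq_iff pres_eq_word_inv word_class_carrier)

lemma relsH_class:
  assumes "(u, v) \<in> relsH" shows "word_class relsH u = word_class relsH v"
  using assms by (simp add: word_class_eq_iff pres_relation)

lemma pow_H: "word_class relsH u [^]\<^bsub>H20\<^esub> (n::nat) = word_class relsH (word_pow u n)"
proof (induction n)
  case 0 show ?case by (simp add: one_H word_pow_def)
next
  case (Suc n)
  have "word_pow u (Suc n) = word_pow u n @ u"
    unfolding word_pow_def by (induction n) simp_all
  then show ?case by (simp only: nat_pow_Suc Suc mult_H)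
qed

lemma relations_H:
  "\<xi>\<^sub>1 [^]\<^bsub>H20\<^esub> (3::nat) = \<one>\<^bsub>H20\<^esub>" "\<xi>\<^sub>2 [^]\<^bsub>H20\<^esub> (3::nat) = \<one>\<^bsub>H20\<^esub>"
  "z\<^sub>1\<^sub>2 [^]\<^bsub>H20\<^esub> (3::nat) = \<one>\<^bsub>H20\<^esub>" "w\<^sub>H [^]\<^bsub>H20\<^esub> (2::nat) = \<one>\<^bsub>H20\<^esub>"
  "z\<^sub>1\<^sub>2 \<otimes>\<^bsub>H20\<^esub> \<xi>\<^sub>1 = \<xi>\<^sub>1 \<otimes>\<^bsub>H20\<^esub> z\<^sub>1\<^sub>2" "z\<^sub>1\<^sub>2 \<otimes>\<^bsub>H20\<^esub> \<xi>\<^sub>2 = \<xi>\<^sub>2 \<otimes>\<^bsub>H20\<^esub> z\<^sub>1\<^sub>2"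
  "z\<^sub>1\<^sub>2 \<otimes>\<^bsub>H20\<^esub> w\<^sub>H = w\<^sub>H \<otimes>\<^bsub>H20\<^esub> z\<^sub>1\<^sub>2"
  "\<xi>\<^sub>2 \<otimes>\<^bsub>H20\<^esub> \<xi>\<^sub>1 = inv\<^bsub>H20\<^esub> z\<^sub>1\<^sub>2 \<otimes>\<^bsub>H20\<^esub> \<xi>\<^sub>1 \<otimes>\<^bsub>H20\<^esub> \<xi>\<^sub>2"
  "w\<^sub>H \<otimes>\<^bsub>H20\<^esub> \<xi>\<^sub>1 \<otimes>\<^bsub>H20\<^esub> inv\<^bsub>H20\<^esub> w\<^sub>H = inv\<^bsub>H20\<^esub> \<xi>\<^sub>1"
  "w\<^sub>H \<otimes>\<^bsub>H20\<^esub> \<xi>\<^sub>2 \<otimes>\<^bsub>H20\<^esub> inv\<^bsub>H20\<^esub> w\<^sub>H = inv\<^bsub>H20\<^esub> \<xi>\<^sub>2"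
  unfolding \<xi>\<^sub>1_def \<xi>\<^sub>2_def z\<^sub>1\<^sub>2_def w\<^sub>H_def
  unfolding pow_H mult_H one_H inv_H append_assoc
  by (rule relsH_class, subst relsH_def, simp only: Let_def, (rule insertI1 | rule insertI2)+)+

text \<open>\<open>elemH \<beta> \<gamma>\<^sub>1 \<gamma>\<^sub>2 \<sigma>\<close> is the element \<open>z\<^sub>1\<^sub>2^\<beta> \<xi>\<^sub>1^\<gamma>\<^sub>1 \<xi>\<^sub>2^\<gamma>\<^sub>2 w^\<sigma>\<close>. Lemma \<open>elemH_bij\<close> shows that
  the normal forms are pairwise distinct and exhaust the group, and \<open>elemH_mult\<close> gives their
  product.\<close>

definition elemH :: "int \<Rightarrow> int \<Rightarrow> int \<Rightarrow> int \<Rightarrow> genH word set" where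
  "elemH \<beta> \<gamma>\<^sub>1 \<gamma>\<^sub>2 \<sigma> = z\<^sub>1\<^sub>2 [^]\<^bsub>H20\<^esub> \<beta> \<otimes>\<^bsub>H20\<^esub> \<xi>\<^sub>1 [^]\<^bsub>H20\<^esub> \<gamma>\<^sub>1 \<otimes>\<^bsub>H20\<^esub> \<xi>\<^sub>2 [^]\<^bsub>H20\<^esub> \<gamma>\<^sub>2 \<otimes>\<^bsub>H20\<^esub> w\<^sub>H [^]\<^bsub>H20\<^esub> \<sigma>"

lemma z_central:
  assumes "x \<in> {\<xi>\<^sub>1, \<xi>\<^sub>2, w\<^sub>H}"
  shows "x [^]\<^bsub>H20\<^esub> (n::int) \<otimes>\<^bsub>H20\<^esub> z\<^sub>1\<^sub>2 [^]\<^bsub>H20\<^esub> (m::int) =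
         z\<^sub>1\<^sub>2 [^]\<^bsub>H20\<^esub> m \<otimes>\<^bsub>H20\<^esub> x [^]\<^bsub>H20\<^esub> n"
proof -
  have c: "x \<in> carrier H20" and e: "z\<^sub>1\<^sub>2 \<otimes>\<^bsub>H20\<^esub> x = x \<otimes>\<^bsub>H20\<^esub> z\<^sub>1\<^sub>2"
    using assms by (auto simp: relations_H)
  have "x [^]\<^bsub>H20\<^esub> n \<otimes>\<^bsub>H20\<^esub> z\<^sub>1\<^sub>2 = z\<^sub>1\<^sub>2 \<otimes>\<^bsub>H20\<^esub> x [^]\<^bsub>H20\<^esub> n"
    using H.commute_int_pow[of x "z\<^sub>1\<^sub>2" x n] c e by simp
  then show ?thesis
    using H.commute_int_pow[of "z\<^sub>1\<^sub>2" "x [^]\<^bsub>H20\<^esub> n" "z\<^sub>1\<^sub>2" m] c by simp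
qed

lemma xi_commute:
  "\<xi>\<^sub>2 [^]\<^bsub>H20\<^esub> (m::int) \<otimes>\<^bsub>H20\<^esub> \<xi>\<^sub>1 [^]\<^bsub>H20\<^esub> (n::int) =
   z\<^sub>1\<^sub>2 [^]\<^bsub>H20\<^esub> (- m * n) \<otimes>\<^bsub>H20\<^esub> \<xi>\<^sub>1 [^]\<^bsub>H20\<^esub> n \<otimes>\<^bsub>H20\<^esub> \<xi>\<^sub>2 [^]\<^bsub>H20\<^esub> m"
proof -
  let ?z = "\<lambda>k::int. z\<^sub>1\<^sub>2 [^]\<^bsub>H20\<^esub> k" and ?x = "\<xi>\<^sub>1 [^]\<^bsub>H20\<^esub> n"
  have zi: "inv\<^bsub>H20\<^esub> z\<^sub>1\<^sub>2 = ?z (-1)" by (simp add: H.int_pow_neg)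
  have zx: "?z k \<otimes>\<^bsub>H20\<^esub> \<xi>\<^sub>1 = \<xi>\<^sub>1 \<otimes>\<^bsub>H20\<^esub> ?z k" "?z k \<otimes>\<^bsub>H20\<^esub> \<xi>\<^sub>2 = \<xi>\<^sub>2 \<otimes>\<^bsub>H20\<^esub> ?z k" for k
    using z_central[of "\<xi>\<^sub>1" 1 k] z_central[of "\<xi>\<^sub>2" 1 k] by simp_all
  have "\<xi>\<^sub>2 \<otimes>\<^bsub>H20\<^esub> ?x = (?z (-1) \<otimes>\<^bsub>H20\<^esub> \<xi>\<^sub>1) [^]\<^bsub>H20\<^esub> n \<otimes>\<^bsub>H20\<^esub> \<xi>\<^sub>2"
    by (rule H.commute_int_pow) (simp_all add: relations_H zi)
  also have "(?z (-1) \<otimes>\<^bsub>H20\<^esub> \<xi>\<^sub>1) [^]\<^bsub>H20\<^esub> n = ?z (- n) \<otimes>\<^bsub>H20\<^esub> ?x"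
    by (subst H.int_pow_mult_distrib) (simp_all add: zx H.int_pow_pow)
  finally have *: "\<xi>\<^sub>2 \<otimes>\<^bsub>H20\<^esub> ?x = ?z (- n) \<otimes>\<^bsub>H20\<^esub> ?x \<otimes>\<^bsub>H20\<^esub> \<xi>\<^sub>2" .
  have "?x \<otimes>\<^bsub>H20\<^esub> \<xi>\<^sub>2 = ?z n \<otimes>\<^bsub>H20\<^esub> ?z (- n) \<otimes>\<^bsub>H20\<^esub> ?x \<otimes>\<^bsub>H20\<^esub> \<xi>\<^sub>2"
    by (simp flip: H.int_pow_mult)
  also have "\<dots> = ?z n \<otimes>\<^bsub>H20\<^esub> (?z (- n) \<otimes>\<^bsub>H20\<^esub> ?x \<otimes>\<^bsub>H20\<^esub> \<xi>\<^sub>2)"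
    by (simp add: H.m_assoc)
  also have "\<dots> = (?z n \<otimes>\<^bsub>H20\<^esub> \<xi>\<^sub>2) \<otimes>\<^bsub>H20\<^esub> ?x"
    unfolding *[symmetric] by (simp add: H.m_assoc)
  finally have "?x \<otimes>\<^bsub>H20\<^esub> \<xi>\<^sub>2 [^]\<^bsub>H20\<^esub> m = (?z n \<otimes>\<^bsub>H20\<^esub> \<xi>\<^sub>2) [^]\<^bsub>H20\<^esub> m \<otimes>\<^bsub>H20\<^esub> ?x"
    by (intro H.commute_int_pow) simp_all
  also have "(?z n \<otimes>\<^bsub>H20\<^esub> \<xi>\<^sub>2) [^]\<^bsub>H20\<^esub> m = ?z (n * m) \<otimes>\<^bsub>H20\<^esub> \<xi>\<^sub>2 [^]\<^bsub>H20\<^esub> m"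
    by (subst H.int_pow_mult_distrib) (simp_all add: zx H.int_pow_pow)
  finally have "?z (- m * n) \<otimes>\<^bsub>H20\<^esub> (?x \<otimes>\<^bsub>H20\<^esub> \<xi>\<^sub>2 [^]\<^bsub>H20\<^esub> m) =
      ?z (- m * n) \<otimes>\<^bsub>H20\<^esub> ?z (n * m) \<otimes>\<^bsub>H20\<^esub> \<xi>\<^sub>2 [^]\<^bsub>H20\<^esub> m \<otimes>\<^bsub>H20\<^esub> ?x"
    by (simp add: H.m_assoc)
  also have "?z (- m * n) \<otimes>\<^bsub>H20\<^esub> ?z (n * m) = \<one>\<^bsub>H20\<^esub>"
    by (simp flip: H.int_pow_mult)
  finally show ?thesis by (simp add: H.m_assoc)
qed

lemma w_commute:
  assumes "x \<in> {\<xi>\<^sub>1, \<xi>\<^sub>2}" "\<sigma> \<in> {0, 1}"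
  shows "w\<^sub>H [^]\<^bsub>H20\<^esub> (\<sigma>::int) \<otimes>\<^bsub>H20\<^esub> x [^]\<^bsub>H20\<^esub> (n::int) =
         x [^]\<^bsub>H20\<^esub> ((-1) ^ nat \<sigma> * n) \<otimes>\<^bsub>H20\<^esub> w\<^sub>H [^]\<^bsub>H20\<^esub> \<sigma>"
proof -
  have c: "x \<in> carrier H20" using assms by auto
  have "w\<^sub>H \<otimes>\<^bsub>H20\<^esub> x = inv\<^bsub>H20\<^esub> x \<otimes>\<^bsub>H20\<^esub> w\<^sub>H"
    using assms(1) relations_H(9,10) c
    by (elim insertE emptyE) (simp_all flip: H.inv_solve_right')
  from H.commute_int_pow[OF _ _ _ this, of n] show ?thesis
    using assms(2) c by (auto simp: H.int_pow_inv H.int_pow_neg)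
qed

lemma elemH_carrier [simp]: "elemH \<beta> \<gamma>\<^sub>1 \<gamma>\<^sub>2 \<sigma> \<in> carrier H20"
  by (simp add: elemH_def)

lemma elemH_mod:
  "elemH (\<beta> mod 3) (\<gamma>\<^sub>1 mod 3) (\<gamma>\<^sub>2 mod 3) (\<sigma> mod 2) = elemH \<beta> \<gamma>\<^sub>1 \<gamma>\<^sub>2 \<sigma>"
  using H.int_pow_mod[of "z\<^sub>1\<^sub>2" 3 \<beta>] H.int_pow_mod[of "\<xi>\<^sub>1" 3 \<gamma>\<^sub>1] H.int_pow_mod[of "\<xi>\<^sub>2" 3 \<gamma>\<^sub>2]
    H.int_pow_mod[of "w\<^sub>H" 2 \<sigma>]
  by (simp add: elemH_def relations_H)

lemma elemH_mult:
  assumes "\<sigma> \<in> {0, 1}"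
  shows "elemH \<beta> \<gamma>\<^sub>1 \<gamma>\<^sub>2 \<sigma> \<otimes>\<^bsub>H20\<^esub> elemH \<beta>' \<gamma>\<^sub>1' \<gamma>\<^sub>2' \<sigma>' =
    elemH ((\<beta> + \<beta>' - \<gamma>\<^sub>2 * (-1) ^ nat \<sigma> * \<gamma>\<^sub>1') mod 3)
      ((\<gamma>\<^sub>1 + (-1) ^ nat \<sigma> * \<gamma>\<^sub>1') mod 3) ((\<gamma>\<^sub>2 + (-1) ^ nat \<sigma> * \<gamma>\<^sub>2') mod 3) ((\<sigma> + \<sigma>') mod 2)"
proof -
  note [simp] = H.m_assoc
  let ?z = "\<lambda>k::int. z\<^sub>1\<^sub>2 [^]\<^bsub>H20\<^esub> k" and ?x = "\<lambda>k::int. \<xi>\<^sub>1 [^]\<^bsub>H20\<^esub> k"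
    and ?y = "\<lambda>k::int. \<xi>\<^sub>2 [^]\<^bsub>H20\<^esub> k" and ?w = "\<lambda>k::int. w\<^sub>H [^]\<^bsub>H20\<^esub> k"
  define s :: int where "s = (-1) ^ nat \<sigma>"
  have L: "a \<otimes>\<^bsub>H20\<^esub> (b \<otimes>\<^bsub>H20\<^esub> r) = c \<otimes>\<^bsub>H20\<^esub> (d \<otimes>\<^bsub>H20\<^esub> r)"
    if "a \<otimes>\<^bsub>H20\<^esub> b = c \<otimes>\<^bsub>H20\<^esub> d"
      "a \<in> carrier H20" "b \<in> carrier H20" "c \<in> carrier H20" "d \<in> carrier H20" "r \<in> carrier H20"
    for a b c d r
    using that by (metis H.m_assoc)
  have zr: "?x n \<otimes>\<^bsub>H20\<^esub> (?z m \<otimes>\<^bsub>H20\<^esub> r) = ?z m \<otimes>\<^bsub>H20\<^esub> (?x n \<otimes>\<^bsub>H20\<^esub> r)"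
    "?y n \<otimes>\<^bsub>H20\<^esub> (?z m \<otimes>\<^bsub>H20\<^esub> r) = ?z m \<otimes>\<^bsub>H20\<^esub> (?y n \<otimes>\<^bsub>H20\<^esub> r)"
    "?w n \<otimes>\<^bsub>H20\<^esub> (?z m \<otimes>\<^bsub>H20\<^esub> r) = ?z m \<otimes>\<^bsub>H20\<^esub> (?w n \<otimes>\<^bsub>H20\<^esub> r)"
    if "r \<in> carrier H20" for n m r
    by (rule L; use that in \<open>simp add: z_central\<close>)+
  have wr: "?w \<sigma> \<otimes>\<^bsub>H20\<^esub> (?x n \<otimes>\<^bsub>H20\<^esub> r) = ?x (s * n) \<otimes>\<^bsub>H20\<^esub> (?w \<sigma> \<otimes>\<^bsub>H20\<^esub> r)"
    "?w \<sigma> \<otimes>\<^bsub>H20\<^esub> (?y n \<otimes>\<^bsub>H20\<^esub> r) = ?y (s * n) \<otimes>\<^bsub>H20\<^esub> (?w \<sigma> \<otimes>\<^bsub>H20\<^esub> r)"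
    if "r \<in> carrier H20" for n r
    unfolding s_def by (rule L; use that assms in \<open>simp add: w_commute\<close>)+
  have yx: "?y m \<otimes>\<^bsub>H20\<^esub> (?x n \<otimes>\<^bsub>H20\<^esub> r) = ?z (- m * n) \<otimes>\<^bsub>H20\<^esub> (?x n \<otimes>\<^bsub>H20\<^esub> (?y m \<otimes>\<^bsub>H20\<^esub> r))"
    if "r \<in> carrier H20" for m n r
  proof -
    have "?y m \<otimes>\<^bsub>H20\<^esub> ?x n = ?z (- m * n) \<otimes>\<^bsub>H20\<^esub> (?x n \<otimes>\<^bsub>H20\<^esub> ?y m)"
      unfolding xi_commute by simp
    from L[OF this] that
    have "?y m \<otimes>\<^bsub>H20\<^esub> (?x n \<otimes>\<^bsub>H20\<^esub> r) = ?z (- m * n) \<otimes>\<^bsub>H20\<^esub> (?x n \<otimes>\<^bsub>H20\<^esub> ?y m \<otimes>\<^bsub>H20\<^esub> r)"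
      by (simp del: H.m_assoc)
    with that show ?thesis by simp
  qed
  have add: "g [^]\<^bsub>H20\<^esub> k \<otimes>\<^bsub>H20\<^esub> (g [^]\<^bsub>H20\<^esub> l \<otimes>\<^bsub>H20\<^esub> r) = g [^]\<^bsub>H20\<^esub> (k + l) \<otimes>\<^bsub>H20\<^esub> r"
    if "g \<in> carrier H20" "r \<in> carrier H20" for g r and k l :: int
    using that by (simp only: H.int_pow_mult H.m_assoc H.int_pow_closed)
  have "elemH \<beta> \<gamma>\<^sub>1 \<gamma>\<^sub>2 \<sigma> \<otimes>\<^bsub>H20\<^esub> elemH \<beta>' \<gamma>\<^sub>1' \<gamma>\<^sub>2' \<sigma>' =
    elemH (\<beta> + \<beta>' - \<gamma>\<^sub>2 * s * \<gamma>\<^sub>1') (\<gamma>\<^sub>1 + s * \<gamma>\<^sub>1') (\<gamma>\<^sub>2 + s * \<gamma>\<^sub>2') (\<sigma> + \<sigma>')"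
    unfolding elemH_def
    by (simp only: H.m_assoc zr wr yx add H.int_pow_mult[symmetric] H.int_pow_closed H.m_closed
          gensH_carrier)
       (simp only: algebra_simps mult_minus_left mult_minus_right add_uminus_conv_diff)
  then show ?thesis unfolding s_def elemH_mod .
qed

text \<open>Left multiplication by the generators on exponent vectors.\<close>

type_synonym quad = "int \<times> int \<times> int \<times> int"

fun actH :: "genH \<times> bool \<Rightarrow> quad \<Rightarrow> quad" where
  "actH (GXi1, p) (b, c, d, s) = (b, (c + (if p then 1 else -1)) mod 3, d, s)"
| "actH (GXi2, p) (b, c, d, s) =
     ((b - (if p then 1 else -1) * c) mod 3, c, (d + (if p then 1 else -1)) mod 3, s)"
| "actH (GZ12, p) (b, c, d, s) = ((b + (if p then 1 else -1)) mod 3, c, d, s)"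
| "actH (GW, p) (b, c, d, s) = (b, (- c) mod 3, (- d) mod 3, (s + 1) mod 2)"

definition quadsH :: "quad set" where "quadsH = {0..<3} \<times> {0..<3} \<times> {0..<3} \<times> {0..<2}"

lemma actH_Q: "q \<in> quadsH \<Longrightarrow> actH l q \<in> quadsH"
  by (cases "(l, q)" rule: actH.cases) (auto simp: quadsH_def)

lemma foldr_actH_Q: "q \<in> quadsH \<Longrightarrow> foldr actH u q \<in> quadsH"
  by (induction u) (auto simp: actH_Q)

lemma Q_cases:
  assumes "(b, c, d, s) \<in> quadsH"
  shows "(b = 0 \<or> b = 1 \<or> b = 2) \<and> (c = 0 \<or> c = 1 \<or> c = 2) \<and> (d = 0 \<or> d = 1 \<or> d = 2) \<and> (s = 0 \<or> s = 1)"
  using assms unfolding quadsH_def by auto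

lemma pres_eq_actH: "pres_eq relsH u v \<Longrightarrow> q \<in> quadsH \<Longrightarrow> foldr actH u q = foldr actH v q"
proof (induction arbitrary: q rule: pres_eq.induct)
  case (pres_refl u)
  show ?case ..
next
  case (pres_sym u v)
  from pres_sym.IH[OF pres_sym.prems] show ?case ..
next
  case (pres_trans u v w)
  from pres_trans.IH(1)[OF pres_trans.prems] pres_trans.IH(2)[OF pres_trans.prems] show ?case by (rule HOL.trans)
next
  case (pres_append u u' v v')
  show ?case using pres_append.IH(2)[OF pres_append.prems] pres_append.IH(1)[OF foldr_actH_Q[OF pres_append.prems]]
    by (simp add: foldr_actH_Q)
next
  case (pres_cancel g b)
  obtain x c d s where q: "q = (x, c, d, s)" by (cases q) auto
  have r: "0 \<le> x" "x < 3" "0 \<le> c" "c < 3" "0 \<le> d" "d < 3" "0 \<le> s" "s < 2"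
    using pres_cancel unfolding q quadsH_def by auto
  have [simp]: "x mod 3 = x" "c mod 3 = c" "d mod 3 = d" "s mod 2 = s"
    using r by simp_all
  show ?case by (cases g; cases b) (simp_all add: q mod_simps)
next
  case (pres_relation u v)
  obtain x c d s where q: "q = (x, c, d, s)" by (cases q) auto
  have r: "0 \<le> x" "x < 3" "0 \<le> c" "c < 3" "0 \<le> d" "d < 3" "0 \<le> s" "s < 2"
    using pres_relation(2) unfolding q quadsH_def by auto
  have [simp]: "x mod 3 = x" "c mod 3 = c" "d mod 3 = d" "s mod 2 = s"
    using r by simp_all
  have "(x - 3 * c) mod 3 = x mod 3" by presburger
  then have A: "(x - 3 * c) mod 3 = x" by simp
  have "\<forall>(u, v) \<in> relsH. foldr actH u q = foldr actH v q"
    unfolding relsH_def Let_def q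
    by (simp add: word_pow_def word_inv_def letter_def eval_nat_numeral mod_simps)
       (intro conjI A; simp add: algebra_simps)
  then show ?case using pres_relation(1) by blast
qed

lemma elemH_bij:
  "bij_betw (\<lambda>(\<beta>, \<gamma>\<^sub>1, \<gamma>\<^sub>2, \<sigma>). elemH \<beta> \<gamma>\<^sub>1 \<gamma>\<^sub>2 \<sigma>)
     ({0..<3} \<times> {0..<3} \<times> {0..<3} \<times> {0..<2}) (carrier H20)"
proof -
  let ?f = "\<lambda>(b, c, d, s). elemH b c d s"
  define nf where "nf b c d s = word_pow (letter GZ12) (nat b) @ word_pow (letter GXi1) (nat c) @
      word_pow (letter GXi2) (nat d) @ word_pow (letter GW) (nat s)" for b c d s :: int
  have nf: "elemH b c d s = word_class relsH (nf b c d s)" if "(b, c, d, s) \<in> quadsH" for b c d s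
  proof -
    have ip: "word_class relsH v [^]\<^bsub>H20\<^esub> k = word_class relsH (word_pow v (nat k))" if "0 \<le> k" for v k
      using that by (simp only: int_pow_def2 pow_H if_False not_less[symmetric])
    have "0 \<le> b" "0 \<le> c" "0 \<le> d" "0 \<le> s" using that by (simp_all add: quadsH_def)
    then show ?thesis
      unfolding elemH_def nf_def \<xi>\<^sub>1_def \<xi>\<^sub>2_def z\<^sub>1\<^sub>2_def w\<^sub>H_def by (simp only: ip mult_H append_assoc)
  qed
  have ev: "foldr actH (nf b c d s) (0, 0, 0, 0) = (b, c, d, s)" if "(b, c, d, s) \<in> quadsH" for b c d s
    using Q_cases[OF that]
    by (elim conjE disjE; simp add: nf_def word_pow_def letter_def eval_nat_numeral)
  have 0: "(0, 0, 0, 0) \<in> quadsH" by (simp add: quadsH_def)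
  have "inj_on ?f quadsH"
  proof (rule inj_onI)
    fix p p' assume Q: "p \<in> quadsH" "p' \<in> quadsH" and eq: "?f p = ?f p'"
    obtain b c d s b' c' d' s' where p: "p = (b, c, d, s)" "p' = (b', c', d', s')"
      by (metis prod_cases4)
    have "pres_eq relsH (nf b c d s) (nf b' c' d' s')"
      using eq Q unfolding p by (simp add: nf word_class_eq_iff)
    from pres_eq_actH[OF this 0] show "p = p'" using Q unfolding p by (simp add: ev)
  qed
  moreover have "?f ` quadsH = carrier H20"
  proof
    show "?f ` quadsH \<subseteq> carrier H20" by auto
    have red: "elemH b c d s \<in> ?f ` quadsH" for b c d s
      by (rule image_eqI[where x = "(b mod 3, c mod 3, d mod 3, s mod 2)"])
         (simp_all add: elemH_mod quadsH_def)
    have gen: "word_class relsH [l] \<in> ?f ` quadsH" for l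
    proof -
      have e: "word_class relsH (letter GXi1) = elemH 0 1 0 0" "word_class relsH (letter GXi2) = elemH 0 0 1 0"
        "word_class relsH (letter GZ12) = elemH 1 0 0 0" "word_class relsH (letter GW) = elemH 0 0 0 1"
        by (simp_all add: elemH_def flip: \<xi>\<^sub>1_def \<xi>\<^sub>2_def z\<^sub>1\<^sub>2_def w\<^sub>H_def)
      have e': "word_class relsH (word_inv (letter GXi1)) = elemH 0 (-1) 0 0"
        "word_class relsH (word_inv (letter GXi2)) = elemH 0 0 (-1) 0"
        "word_class relsH (word_inv (letter GZ12)) = elemH (-1) 0 0 0"
        "word_class relsH (word_inv (letter GW)) = elemH 0 0 0 (-1)"
        by (simp_all add: elemH_def H.int_pow_neg flip: inv_H \<xi>\<^sub>1_def \<xi>\<^sub>2_def z\<^sub>1\<^sub>2_def w\<^sub>H_def)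
      obtain g b where "l = (g, b)" by fastforce
      then have "[l] = (if b then letter g else word_inv (letter g))"
        by (simp add: letter_def word_inv_def)
      then show ?thesis by (cases g; cases b) (simp_all only: if_True if_False e e' red)
    qed
    have "word_class relsH u \<in> ?f ` quadsH" for u
    proof (induction u)
      case Nil
      have "word_class relsH [] = elemH 0 0 0 0" by (simp add: elemH_def one_H[symmetric])
      then show ?case by (simp only: red)
    next
      case (Cons l u)
      then obtain b c d s b' c' d' s' where *: "word_class relsH [l] = elemH b c d s" "(b, c, d, s) \<in> quadsH"
        "word_class relsH u = elemH b' c' d' s'" using gen[of l] by auto
      then have "s \<in> {0, 1}" using Q_cases by blast
      have "word_class relsH (l # u) = elemH b c d s \<otimes>\<^bsub>H20\<^esub> elemH b' c' d' s'"
        using mult_H[of "[l]" u] * by simp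
      then show ?case by (simp only: elemH_mult[OF \<open>s \<in> {0, 1}\<close>] red)
    qed
    then show "carrier H20 \<subseteq> ?f ` quadsH" by (auto simp: H20_def carrier_presented)
  qed
  ultimately show ?thesis by (simp add: bij_betw_def quadsH_def)
qed

end

end

theory Submission
  imports Defs
begin

text \<open>
  The multiplication rule for the normal forms \<open>z\<^sub>1\<^sub>2^\<beta> \<xi>\<^sub>1^\<gamma>\<^sub>1 \<xi>\<^sub>2^\<gamma>\<^sub>2 w^\<sigma>\<close> of \<open>H = H20\<close> reduces every
  statement about \<open>H\<close> itself to arithmetic modulo 3 and 2: the centre is \<open>\<langle>z\<^sub>1\<^sub>2\<rangle>\<close>, the element \<open>z\<^sub>1\<^sub>2\<close>
  is the commutator of \<open>\<xi>\<^sub>1\<close> and \<open>\<xi>\<^sub>2\<close>, and the semidirect decompositions can be read off.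

  Groups given by presentations are compared with \<open>H\<close> through the universal property. For
  \<open>P = G20\<close>, \<open>P = SmallGroup_18_4\<close> and \<open>P = SmallGroup_54_8\<close> the relations of \<open>H\<close> hold for suitable
  elements of \<open>P\<close>, which gives a homomorphism \<open>p\<close> from \<open>H\<close> to \<open>P\<close>. Conversely, the relations of
  \<open>P\<close> hold in \<open>H\<close> modulo a normal subgroup \<open>N\<close> on which \<open>p\<close> is trivial, which gives a homomorphism
  from \<open>P\<close> to \<open>H/N\<close> inverse to the one induced by \<open>p\<close>; so \<open>p\<close> is surjective with kernel \<open>N\<close>
  (\<open>presented_hom_kernel\<close>). Here \<open>N = \<langle>z\<^sub>1\<^sub>2\<rangle>\<close> in the first two cases and \<open>N = 1\<close> in the third. In
  particular \<open>H/Z(H) \<cong> G20 \<cong> SmallGroup_18_4\<close>.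

  The Schur multiplier of \<open>G = G20\<close> is computed from the central extension \<open>p : H \<rightarrow> G\<close> with kernel
  \<open>A = \<langle>z\<^sub>1\<^sub>2\<rangle>\<close>. Composing a character \<open>\<chi>\<close> of \<open>A\<close> with the factor set of a section of \<open>p\<close> gives a
  cocycle of \<open>G\<close>, the transgression of \<open>\<chi>\<close>, and it remains to see that this sets up a bijection
  between the three characters of \<open>A\<close> and the cohomology classes.

  It is injective because \<open>z\<^sub>1\<^sub>2\<close> is the commutator of two elements with commuting images in \<open>G\<close>: a
  coboundary takes the same value at \<open>(x, y)\<close> and \<open>(y, x)\<close> if \<open>x\<close> and \<open>y\<close> commute, and for a
  transgression the quotient of the two values is \<open>\<chi>\<close> of the commutator of lifts
  (\<open>transgress_coboundary_imp_trivial\<close>).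

  It is surjective because every cocycle \<open>f\<close> defines a central extension \<open>E\<close> of \<open>G\<close> by
  \<open>\<complex>\<^sup>\<times>\<close>, and \<open>p\<close> lifts to a homomorphism from \<open>H\<close> to \<open>E\<close> (\<open>H20_hom_to_cocycle_extension\<close>);
  restricted to \<open>A\<close> the latter is a character whose transgression is cohomologous to \<open>f\<close>
  (\<open>cocycle_cohomologous_transgress\<close>). For the lift it suffices to find preimages in \<open>E\<close> of the
  images of \<open>\<xi>\<^sub>1\<close>, \<open>\<xi>\<^sub>2\<close>, \<open>w\<close> that satisfy the relations of \<open>H\<close>. As \<open>\<complex>\<^sup>\<times>\<close> has square roots, a
  preimage \<open>W\<close> of the image of \<open>w\<close> can be scaled to an involution, and a preimage \<open>X\<close> of the image of
  \<open>\<xi>\<^sub>i\<close> to one inverted by \<open>W\<close>. Then the scalar \<open>X\<^sup>3\<close> is its own inverse, and multiplying \<open>X\<close>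
  by it yields a preimage of order dividing 3 (\<open>central_lift_inverted\<close>). The commutator of the two
  preimages obtained in this way is a scalar, whose cube is 1 since they have order dividing 3
  (\<open>central_commutator\<close>).
\<close>

section \<open>Homomorphisms out of a presented group\<close>

text \<open>The value of a word in \<open>K\<close> when the generator \<open>g\<close> is interpreted as \<open>f g\<close>.\<close>

definition word_eval :: "('a, 'm) monoid_scheme \<Rightarrow> ('g \<Rightarrow> 'a) \<Rightarrow> 'g word \<Rightarrow> 'a" where
  "word_eval K f u =
     foldr (\<lambda>(g, b) x. (if b then f g else inv\<^bsub>K\<^esub> f g) \<otimes>\<^bsub>K\<^esub> x) u \<one>\<^bsub>K\<^esub>"

text \<open>The map on word classes induced by \<open>f\<close>. It evaluates an arbitrary representative, so it is
  meaningful only if \<open>f\<close> respects the relations (\<open>pres_hom_class\<close>).\<close>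

definition pres_hom :: "('a, 'm) monoid_scheme \<Rightarrow> ('g \<Rightarrow> 'a) \<Rightarrow> 'g word set \<Rightarrow> 'a" where
  "pres_hom K f U = word_eval K f (SOME u. u \<in> U)"

lemma word_eval_simps [simp]:
  "word_eval K f [] = \<one>\<^bsub>K\<^esub>"
  "word_eval K f ((g, b) # u) = (if b then f g else inv\<^bsub>K\<^esub> f g) \<otimes>\<^bsub>K\<^esub> word_eval K f u"
  by (simp_all add: word_eval_def)

lemmas word_defs = letter_def word_inv_def word_pow_def numeral_2_eq_2 numeral_3_eq_3

context group
begin

lemma word_eval_closed [simp]: "range f \<subseteq> carrier G \<Longrightarrow> word_eval G f u \<in> carrier G"
  by (induction u) (auto simp: subset_iff)

lemma word_eval_append:
  assumes "range f \<subseteq> carrier G"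
  shows "word_eval G f (u @ v) = word_eval G f u \<otimes> word_eval G f v"
proof (induction u)
  case (Cons l u)
  obtain g b where l: "l = (g, b)" by fastforce
  have "f g \<in> carrier G" using assms by auto
  then show ?case using Cons assms by (simp add: l m_assoc)
qed (simp add: assms)

lemma word_eval_pres_eq:
  assumes f: "range f \<subseteq> carrier G"
    and R: "\<forall>(u, v)\<in>R. word_eval G f u = word_eval G f v"
  shows "pres_eq R u v \<Longrightarrow> word_eval G f u = word_eval G f v"
proof (induction rule: pres_eq.induct)
  case (pres_cancel g b)
  have "f g \<in> carrier G" using f by auto
  then show ?case by simp
qed (use R in \<open>auto simp: word_eval_append f\<close>)

lemma pres_hom_class:
  assumes "range f \<subseteq> carrier G"
    and "\<forall>(u, v)\<in>R. word_eval G f u = word_eval G f v"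
  shows "pres_hom G f (word_class R u) = word_eval G f u"
proof -
  have "u \<in> word_class R u" by (simp add: word_class_def pres_refl)
  then have "(SOME v. v \<in> word_class R u) \<in> word_class R u" by (rule someI)
  then have "pres_eq R u (SOME v. v \<in> word_class R u)"
    by (subst (asm) (2) word_class_def) simp
  from word_eval_pres_eq[OF assms this] show ?thesis by (simp add: pres_hom_def)
qed

lemma pres_hom_letter:
  assumes "range f \<subseteq> carrier G"
    and "\<forall>(u, v)\<in>R. word_eval G f u = word_eval G f v"
  shows "pres_hom G f (word_class R (letter g)) = f g"
proof -
  have "f g \<in> carrier G" using assms(1) by auto
  then show ?thesis unfolding pres_hom_class[OF assms] by (simp add: letter_def)
qed

text \<open>The universal property of a presentation: an assignment of the generators that respects the
  relations extends to a homomorphism.\<close>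

lemma pres_hom_hom:
  assumes "range f \<subseteq> carrier G"
    and "\<forall>(u, v)\<in>R. word_eval G f u = word_eval G f v"
  shows "group_hom (presented_group R) G (pres_hom G f)"
proof (intro group_hom.intro group_hom_axioms.intro homI group_presented_group is_group)
  show "pres_hom G f U \<in> carrier G" for U
    using assms(1) by (simp add: pres_hom_def)
  show "pres_hom G f (U \<otimes>\<^bsub>presented_group R\<^esub> V) = pres_hom G f U \<otimes> pres_hom G f V"
    if "U \<in> carrier (presented_group R)" "V \<in> carrier (presented_group R)" for U V
    using that assms(1)
    by (auto simp: carrier_presented mult_presented pres_hom_class[OF assms] word_eval_append)
qed

end

lemma word_class_presented_carrier [simp]: "word_class R u \<in> carrier (presented_group R)"
  by (simp add: carrier_presented)

lemma letter_inv:
  "inv\<^bsub>presented_group R\<^esub> word_class R (letter g) = word_class R [(g, False)]"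
proof -
  interpret P: group "presented_group R" by (rule group_presented_group)
  show ?thesis
    by (rule P.inv_equality)
       (simp_all add: mult_presented one_presented letter_def word_class_eq_iff
         pres_cancel[of R g False, simplified])
qed

text \<open>A presented group is generated by the classes of the letters.\<close>

lemma presented_generated:
  assumes S: "subgroup S (presented_group R)" and g: "\<And>g. word_class R (letter g) \<in> S"
  shows "S = carrier (presented_group R)"
proof -
  have l: "word_class R [l] \<in> S" for l
  proof (cases l)
    case (Pair g b)
    show ?thesis
      using g[of g] subgroup.m_inv_closed[OF S g[of g]]
      by (cases b) (simp_all add: Pair letter_inv, simp add: letter_def)
  qed
  have "word_class R u \<in> S" for u
  proof (induction u)
    case Nil
    show ?case using subgroup.one_closed[OF S] by (simp add: one_presented)
  next
    case (Cons l u)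
    show ?case using subgroup.m_closed[OF S l[of l] Cons] by (simp add: mult_presented)
  qed
  then show ?thesis using subgroup.subset[OF S] by (auto simp: carrier_presented)
qed

lemma word_eval_letter:
  "word_eval (presented_group R) (\<lambda>g. word_class R (letter g)) u = word_class R u"
proof (induction u)
  case (Cons l u)
  obtain g b where "l = (g, b)" by fastforce
  then show ?case
    using Cons by (cases b) (simp_all add: letter_inv mult_presented, simp add: letter_def mult_presented)
qed (simp add: one_presented)

lemma presented_relations:
  "\<forall>(u, v)\<in>R. word_eval (presented_group R) (\<lambda>g. word_class R (letter g)) u =
     word_eval (presented_group R) (\<lambda>g. word_class R (letter g)) v"
  by (auto simp: word_eval_letter word_class_eq_iff pres_relation)

lemma presented_hom_surj:
  assumes "group_hom K (presented_group R) h" and "\<And>g. word_class R (letter g) \<in> h ` carrier K"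
  shows "h ` carrier K = carrier (presented_group R)"
  by (rule presented_generated[OF group_hom.img_is_subgroup[OF assms(1)] assms(2)])

lemma presented_hom_eqI:
  assumes h: "group_hom (presented_group R) K h" and h': "group_hom (presented_group R) K h'"
    and eq: "\<And>g. h (word_class R (letter g)) = h' (word_class R (letter g))"
    and x: "x \<in> carrier (presented_group R)"
  shows "h x = h' x"
proof -
  interpret h: group_hom "presented_group R" K h by (rule h)
  interpret h': group_hom "presented_group R" K h' by (rule h')
  let ?S = "{x \<in> carrier (presented_group R). h x = h' x}"
  have "subgroup ?S (presented_group R)" by (rule h.G.subgroupI) (auto intro: exI[of _ "\<one>\<^bsub>presented_group R\<^esub>"])
  then have "?S = carrier (presented_group R)"
    by (rule presented_generated) (simp add: eq)
  with x show ?thesis by blast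
qed

lemma word_eval_hom:
  assumes "group_hom K L h" and f: "range f \<subseteq> carrier K"
  shows "word_eval L (\<lambda>g. h (f g)) u = h (word_eval K f u)"
proof -
  interpret group_hom K L h by fact
  show ?thesis
  proof (induction u)
    case (Cons l u)
    obtain g b where l: "l = (g, b)" by fastforce
    have "f g \<in> carrier K" using f by auto
    then show ?case using Cons f by (simp add: l)
  qed simp
qed

text \<open>
  Recognition of a presented group as a quotient of another one. The generators of the target are
  lifted along \<open>p\<close> to elements \<open>f g\<close> that satisfy the relations of the target modulo \<open>N\<close>; this
  gives a homomorphism from the target to \<open>K Mod N\<close>, and \<open>pe\<close> with \<open>fe\<close> says that its composition
  with \<open>p\<close> is the projection on generators. The words \<open>e g\<close> express the images under \<open>p\<close> of the
  generators of \<open>K\<close>.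
\<close>

lemma presented_hom_kernel:
  fixes R :: "('g word \<times> 'g word) set" and R' :: "('h word \<times> 'h word) set"
  defines "K \<equiv> presented_group R'"
  assumes p: "group_hom K (presented_group R) p"
    and N: "N \<lhd> K" "N \<subseteq> kernel K (presented_group R) p"
    and f: "range f \<subseteq> carrier K"
    and rel: "\<forall>(u, v)\<in>R. N #>\<^bsub>K\<^esub> word_eval K f u = N #>\<^bsub>K\<^esub> word_eval K f v"
    and pf: "\<And>g. p (f g) = word_class R (letter g)"
    and pe: "\<And>g. p (word_class R' (letter g)) = word_class R (e g)"
    and fe: "\<And>g. N #>\<^bsub>K\<^esub> word_eval K f (e g) = N #>\<^bsub>K\<^esub> word_class R' (letter g)"
  shows "kernel K (presented_group R) p = N" "p ` carrier K = carrier (presented_group R)"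
proof -
  interpret p: group_hom K "presented_group R" p by (rule p)
  interpret N: normal N K by (rule N(1))
  interpret Q: group "K Mod N" by (rule N.factorgroup_is_group)
  have c: "group_hom K (K Mod N) (\<lambda>x. N #>\<^bsub>K\<^esub> x)"
    by (intro group_hom.intro group_hom_axioms.intro N.r_coset_hom_Mod p.G.is_group Q.is_group)
  let ?f = "\<lambda>g. N #>\<^bsub>K\<^esub> f g"
  have f': "range ?f \<subseteq> carrier (K Mod N)"
    using f by (auto simp: carrier_FactGroup)
  have ev: "word_eval (K Mod N) ?f u = N #>\<^bsub>K\<^esub> word_eval K f u" for u
    by (rule word_eval_hom[OF c f])
  have rel': "\<forall>(u, v)\<in>R. word_eval (K Mod N) ?f u = word_eval (K Mod N) ?f v"
    using rel by (simp add: ev)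
  define q where "q = pres_hom (K Mod N) ?f"
  have q: "group_hom (presented_group R) (K Mod N) q"
    unfolding q_def by (rule Q.pres_hom_hom[OF f' rel'])
  have "group_hom (presented_group R') (K Mod N) (q \<circ> p)"
    using hom_compose[OF p.homh group_hom.homh[OF q]] p.G.is_group Q.is_group
    unfolding K_def by (intro group_hom.intro group_hom_axioms.intro)
  moreover have "(q \<circ> p) (word_class R' (letter g)) = N #>\<^bsub>K\<^esub> word_class R' (letter g)" for g
    by (simp add: pe q_def Q.pres_hom_class[OF f' rel'] ev fe)
  ultimately have qp: "q (p x) = N #>\<^bsub>K\<^esub> x" if "x \<in> carrier K" for x
    using presented_hom_eqI[of R' "K Mod N" "q \<circ> p" "\<lambda>x. N #>\<^bsub>K\<^esub> x" x] c that by (simp add: K_def)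
  show "kernel K (presented_group R) p = N"
  proof (intro equalityI N(2) subsetI)
    fix x assume "x \<in> kernel K (presented_group R) p"
    then have x: "x \<in> carrier K" "p x = \<one>\<^bsub>presented_group R\<^esub>" by (auto simp: kernel_def)
    have "N #>\<^bsub>K\<^esub> x = N"
      using qp[OF x(1)] group_hom.hom_one[OF q] by (simp add: x(2))
    with p.G.rcos_self[OF x(1) N.subgroup_axioms] show "x \<in> N" by simp
  qed
  have "word_class R (letter g) \<in> p ` carrier K" for g
    using f unfolding pf[symmetric] by blast
  then show "p ` carrier K = carrier (presented_group R)" by (rule presented_hom_surj[OF p])
qed

section \<open>The group of order 54\<close>

interpretation H: group H20
  unfolding H20_def by (rule group_presented_group)

lemma elemH_gens:
  "\<xi>\<^sub>1 = elemH 0 1 0 0" "\<xi>\<^sub>2 = elemH 0 0 1 0" "z\<^sub>1\<^sub>2 = elemH 1 0 0 0" "w\<^sub>H = elemH 0 0 0 1"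
  "\<one>\<^bsub>H20\<^esub> = elemH 0 0 0 0"
  by (simp_all add: elemH_def)

lemma elemH_exhaust:
  assumes "x \<in> carrier H20"
  obtains b c d s where "x = elemH b c d s" "s \<in> {0, 1}" "(b, c, d, s) \<in> quadsH"
proof -
  have "x \<in> (\<lambda>(b, c, d, s). elemH b c d s) ` quadsH"
    using assms unfolding quadsH_def bij_betw_imp_surj_on[OF elemH_bij] .
  then obtain q where q: "q \<in> quadsH" "x = (\<lambda>(b, c, d, s). elemH b c d s) q"
    by (elim imageE)
  obtain b c d s where "q = (b, c, d, s)" by (cases q) auto
  moreover from this have "s \<in> {0, 1}" using q(1) Q_cases by blast
  ultimately show thesis using that q by simp
qed

lemma elemH_eq_iff:
  "elemH b c d s = elemH b' c' d' s' \<longleftrightarrow>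
     b mod 3 = b' mod 3 \<and> c mod 3 = c' mod 3 \<and> d mod 3 = d' mod 3 \<and> s mod 2 = s' mod 2"
    (is "?l \<longleftrightarrow> ?r")
proof
  assume ?l
  then have "elemH (b mod 3) (c mod 3) (d mod 3) (s mod 2) =
      elemH (b' mod 3) (c' mod 3) (d' mod 3) (s' mod 2)" by (simp add: elemH_mod)
  moreover have "(b mod 3, c mod 3, d mod 3, s mod 2) \<in> quadsH" for b c d s
    by (simp add: quadsH_def)
  ultimately have "(b mod 3, c mod 3, d mod 3, s mod 2) = (b' mod 3, c' mod 3, d' mod 3, s' mod 2)"
    using bij_betw_imp_inj_on[OF elemH_bij] unfolding quadsH_def[symmetric]
    by (elim inj_onD) simp_all
  then show ?r by simp
next
  assume ?r
  then show ?l using elemH_mod[of b c d s] elemH_mod[of b' c' d' s'] by simp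
qed

text \<open>The product of normal forms without reduction of the exponents, split by the exponent of \<open>w\<close>.\<close>

lemma elemH_mult_0:
  "elemH b c d 0 \<otimes>\<^bsub>H20\<^esub> elemH b' c' d' s' = elemH (b + b' - d * c') (c + c') (d + d') s'"
  by (subst elemH_mult) (simp_all add: elemH_mod mod_simps elemH_eq_iff)

lemma elemH_mult_1:
  "elemH b c d 1 \<otimes>\<^bsub>H20\<^esub> elemH b' c' d' s' = elemH (b + b' + d * c') (c - c') (d - d') (1 + s')"
  by (subst elemH_mult) (simp_all add: elemH_mod mod_simps elemH_eq_iff)

lemma elemH_inv_0: "inv\<^bsub>H20\<^esub> elemH b c d 0 = elemH (- b - c * d) (- c) (- d) 0"
  by (rule H.inv_equality) (simp_all add: elemH_mult_0 elemH_gens)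

lemma elemH_inv_1: "inv\<^bsub>H20\<^esub> elemH b c d 1 = elemH (- b - c * d) c d 1"
  by (rule H.inv_equality) (simp_all add: elemH_mult_1 elemH_gens elemH_eq_iff algebra_simps)

lemmas elemH_calc = elemH_mult_0 elemH_mult_1 elemH_inv_0 elemH_inv_1

lemma elemH_pow: "z\<^sub>1\<^sub>2 [^]\<^bsub>H20\<^esub> (k::int) = elemH k 0 0 0" "\<xi>\<^sub>1 [^]\<^bsub>H20\<^esub> k = elemH 0 k 0 0"
  "\<xi>\<^sub>2 [^]\<^bsub>H20\<^esub> k = elemH 0 0 k 0" "w\<^sub>H [^]\<^bsub>H20\<^esub> k = elemH 0 0 0 k"
  by (simp_all add: elemH_def)

lemma Z12_eq: "Z\<^sub>1\<^sub>2 = range (\<lambda>k. elemH k 0 0 0)"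
  and Xi1_eq: "\<Xi>\<^sub>1 = range (\<lambda>k. elemH 0 k 0 0)"
  and Xi2_eq: "\<Xi>\<^sub>2 = range (\<lambda>k. elemH 0 0 k 0)"
  and W_eq: "W\<^sub>H = range (\<lambda>k. elemH 0 0 0 k)"
  unfolding Z\<^sub>1\<^sub>2_def \<Xi>\<^sub>1_def \<Xi>\<^sub>2_def W\<^sub>H_def
  by (subst H.generate_pow; force simp: elemH_pow)+

lemma subgroups_H20: "subgroup Z\<^sub>1\<^sub>2 H20" "subgroup \<Xi>\<^sub>1 H20" "subgroup \<Xi>\<^sub>2 H20" "subgroup W\<^sub>H H20"
  unfolding Z\<^sub>1\<^sub>2_def \<Xi>\<^sub>1_def \<Xi>\<^sub>2_def W\<^sub>H_def by (simp_all add: H.generate_is_subgroup)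

lemma center_H20: "center H20 = Z\<^sub>1\<^sub>2"
proof (intro equalityI subsetI)
  fix x assume "x \<in> Z\<^sub>1\<^sub>2"
  then obtain k where x: "x = elemH k 0 0 0" unfolding Z12_eq by blast
  have "x \<otimes>\<^bsub>H20\<^esub> y = y \<otimes>\<^bsub>H20\<^esub> x" if "y \<in> carrier H20" for y
  proof -
    from that show ?thesis
      by (rule elemH_exhaust) (auto simp: x elemH_calc add.commute)
  qed
  then show "x \<in> center H20" by (simp add: center_def x)
next
  fix x assume x: "x \<in> center H20"
  then have "x \<in> carrier H20" by (simp add: center_def)
  then obtain b c d s where x': "x = elemH b c d s" and s: "s \<in> {0, 1}" and q: "(b, c, d, s) \<in> quadsH"
    by (rule elemH_exhaust)
  have "x \<otimes>\<^bsub>H20\<^esub> elemH 0 1 0 0 = elemH 0 1 0 0 \<otimes>\<^bsub>H20\<^esub> x"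
    "x \<otimes>\<^bsub>H20\<^esub> elemH 0 0 0 1 = elemH 0 0 0 1 \<otimes>\<^bsub>H20\<^esub> x"
    using x unfolding center_def by simp_all
  then have "c = 0 \<and> d = 0 \<and> s = 0"
    using s Q_cases[OF q] by (auto simp: x' elemH_calc elemH_eq_iff)
  then show "x \<in> Z\<^sub>1\<^sub>2" by (auto simp: x' Z12_eq)
qed

lemma Z12_normal: "Z\<^sub>1\<^sub>2 \<lhd> H20"
proof (rule H.normal_invI[OF subgroups_H20(1)])
  fix x h assume x: "x \<in> carrier H20" and h: "h \<in> Z\<^sub>1\<^sub>2"
  then have "x \<otimes>\<^bsub>H20\<^esub> h = h \<otimes>\<^bsub>H20\<^esub> x" "h \<in> carrier H20"
    unfolding center_H20[symmetric] by (auto simp: center_def)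
  with x h show "x \<otimes>\<^bsub>H20\<^esub> h \<otimes>\<^bsub>H20\<^esub> inv\<^bsub>H20\<^esub> x \<in> Z\<^sub>1\<^sub>2" by (simp add: H.m_assoc)
qed

lemma commutator_xi: "z\<^sub>1\<^sub>2 = \<xi>\<^sub>1 \<otimes>\<^bsub>H20\<^esub> \<xi>\<^sub>2 \<otimes>\<^bsub>H20\<^esub> inv\<^bsub>H20\<^esub> \<xi>\<^sub>1 \<otimes>\<^bsub>H20\<^esub> inv\<^bsub>H20\<^esub> \<xi>\<^sub>2"
  by (simp add: elemH_gens elemH_calc elemH_eq_iff)

lemma Z12_derived: "Z\<^sub>1\<^sub>2 \<subseteq> derived H20 (carrier H20)"
  unfolding derived_def Z\<^sub>1\<^sub>2_def
  by (rule H.mono_generate) (use commutator_xi gensH_carrier in blast)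

lemma Z12_coset_eq_iff:
  "Z\<^sub>1\<^sub>2 #>\<^bsub>H20\<^esub> elemH b c d s = Z\<^sub>1\<^sub>2 #>\<^bsub>H20\<^esub> elemH b' c' d' s' \<longleftrightarrow>
     c mod 3 = c' mod 3 \<and> d mod 3 = d' mod 3 \<and> s mod 2 = s' mod 2"
proof -
  have coset: "Z\<^sub>1\<^sub>2 #>\<^bsub>H20\<^esub> elemH b c d s = range (\<lambda>k. elemH k c d s)" for b c d s
  proof -
    have "range (\<lambda>k. elemH (k + b) c d s) = range (\<lambda>k. elemH k c d s)"
      by (auto simp: image_iff) (metis add.commute diff_add_cancel)
    moreover have "Z\<^sub>1\<^sub>2 #>\<^bsub>H20\<^esub> elemH b c d s = range (\<lambda>k. elemH (k + b) c d s)"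
      by (auto simp: r_coset_def Z12_eq elemH_mult_0)
    ultimately show ?thesis by simp
  qed
  have "range (\<lambda>k. elemH k c d s) = range (\<lambda>k. elemH k c' d' s')"
    if "c mod 3 = c' mod 3 \<and> d mod 3 = d' mod 3 \<and> s mod 2 = s' mod 2"
    by (rule image_cong) (simp_all add: elemH_eq_iff that)
  moreover have "c mod 3 = c' mod 3 \<and> d mod 3 = d' mod 3 \<and> s mod 2 = s' mod 2"
    if "range (\<lambda>k. elemH k c d s) = range (\<lambda>k. elemH k c' d' s')"
  proof -
    have "elemH 0 c d s \<in> range (\<lambda>k. elemH k c' d' s')" unfolding that[symmetric] by blast
    then show ?thesis by (auto simp: elemH_eq_iff)
  qed
  ultimately show ?thesis unfolding coset by blast
qed

section \<open>Homomorphisms from \<open>H20\<close> to the other presented groups\<close>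

text \<open>The relations of \<open>H20\<close> in evaluated form. Since \<open>w\<close> is an involution, conjugation by \<open>w\<close> is
  written without inverses, and the commutator relation is solved for \<open>x\<^sub>1 \<otimes> x\<^sub>2\<close>.\<close>

lemma (in group) relsH_eval:
  assumes [simp]: "x\<^sub>1 \<in> carrier G" "x\<^sub>2 \<in> carrier G" "z \<in> carrier G" "w \<in> carrier G"
    and "x\<^sub>1 \<otimes> (x\<^sub>1 \<otimes> x\<^sub>1) = \<one>" "x\<^sub>2 \<otimes> (x\<^sub>2 \<otimes> x\<^sub>2) = \<one>" "z \<otimes> (z \<otimes> z) = \<one>" "w \<otimes> w = \<one>"
      "z \<otimes> x\<^sub>1 = x\<^sub>1 \<otimes> z" "z \<otimes> x\<^sub>2 = x\<^sub>2 \<otimes> z" "z \<otimes> w = w \<otimes> z"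
      "x\<^sub>1 \<otimes> x\<^sub>2 = z \<otimes> (x\<^sub>2 \<otimes> x\<^sub>1)"
      "w \<otimes> (x\<^sub>1 \<otimes> w) = inv x\<^sub>1" "w \<otimes> (x\<^sub>2 \<otimes> w) = inv x\<^sub>2"
  shows "\<forall>(u, v)\<in>relsH. word_eval G (case_genH x\<^sub>1 x\<^sub>2 z w) u = word_eval G (case_genH x\<^sub>1 x\<^sub>2 z w) v"
proof -
  have "inv w = w" using assms(8) by (intro inv_equality) auto
  moreover have "x\<^sub>2 \<otimes> x\<^sub>1 = inv z \<otimes> (x\<^sub>1 \<otimes> x\<^sub>2)"
    unfolding assms(12) by (simp flip: m_assoc)
  ultimately show ?thesis
    using assms(5-) by (simp add: relsH_def Let_def word_defs)
qed

text \<open>Names for the relation sets of the remaining presentations.\<close>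

definition relsG20 :: "(gen20 word \<times> gen20 word) set" where
  "relsG20 = (let a = letter A20; b = letter B20; c = letter C20 in
      {(word_pow a 2, []), (word_pow b 2, []), (word_pow c 2, []),
       (word_pow (a @ b @ c) 2, []), (word_pow (a @ b) 3, []), (word_pow (a @ c) 3, [])})"

definition rels18 :: "(pc3 word \<times> pc3 word) set" where
  "rels18 = (let f1 = letter P1; f2 = letter P2; f3 = letter P3 in
      {(word_pow f1 2, []), (word_pow f2 3, []), (word_pow f3 3, []),
       (word_inv f1 @ f2 @ f1, word_pow f2 2),
       (word_inv f1 @ f3 @ f1, word_pow f3 2),
       (word_inv f2 @ f3 @ f2, f3)})"

definition rels54 :: "(pc4 word \<times> pc4 word) set" where
  "rels54 = (let f1 = letter F1; f2 = letter F2; f3 = letter F3; f4 = letter F4 in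
      {(word_pow f1 2, []), (word_pow f2 3, []), (word_pow f3 3, []), (word_pow f4 3, []),
       (word_inv f1 @ f2 @ f1, word_pow f2 2),
       (word_inv f1 @ f3 @ f1, word_pow f3 2),
       (word_inv f1 @ f4 @ f1, f4),
       (word_inv f2 @ f3 @ f2, f3 @ f4),
       (word_inv f2 @ f4 @ f2, f4),
       (word_inv f3 @ f4 @ f3, f4)})"

lemma presentations: "G20 = presented_group relsG20" "SmallGroup_18_4 = presented_group rels18"
  "SmallGroup_54_8 = presented_group rels54"
  by (simp_all only: G20_def relsG20_def SmallGroup_18_4_def rels18_def SmallGroup_54_8_def rels54_def Let_def)

text \<open>The covering map \<open>\<xi>\<^sub>1 \<mapsto> ab\<close>, \<open>\<xi>\<^sub>2 \<mapsto> ca\<close>, \<open>z\<^sub>1\<^sub>2 \<mapsto> 1\<close>, \<open>w \<mapsto> a\<close> respects the relations of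
  \<open>H20\<close>.\<close>

lemma (in group) G20_imp_relsH:
  assumes [simp]: "a \<in> carrier G" "b \<in> carrier G" "c \<in> carrier G"
    and r: "a \<otimes> a = \<one>" "b \<otimes> b = \<one>" "c \<otimes> c = \<one>"
      "a \<otimes> (b \<otimes> (c \<otimes> (a \<otimes> (b \<otimes> c)))) = \<one>"
      "a \<otimes> (b \<otimes> (a \<otimes> (b \<otimes> (a \<otimes> b)))) = \<one>" "a \<otimes> (c \<otimes> (a \<otimes> (c \<otimes> (a \<otimes> c)))) = \<one>"
  shows "\<forall>(u, v)\<in>relsH. word_eval G (case_genH (a \<otimes> b) (c \<otimes> a) \<one> a) u =
    word_eval G (case_genH (a \<otimes> b) (c \<otimes> a) \<one> a) v"
proof -
  have inv: "inv a = a" "inv b = b" "inv c = c" by (rule inv_equality; simp add: r)+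
  have aa: "a \<otimes> (a \<otimes> x) = x" "b \<otimes> (b \<otimes> x) = x" "c \<otimes> (c \<otimes> x) = x" if "x \<in> carrier G" for x
    using that by (simp_all add: r flip: m_assoc)
  have "inv (a \<otimes> (c \<otimes> (a \<otimes> (c \<otimes> (a \<otimes> c))))) = \<one>" unfolding r(6) by simp
  then have 1: "c \<otimes> (a \<otimes> (c \<otimes> (a \<otimes> (c \<otimes> a)))) = \<one>"
    by (simp add: inv_mult_group inv m_assoc)
  have "a \<otimes> (b \<otimes> c) = inv (a \<otimes> (b \<otimes> c))"
    by (rule sym, rule inv_equality) (simp_all add: m_assoc r)
  then have 2: "a \<otimes> (b \<otimes> c) = c \<otimes> (b \<otimes> a)"
    by (simp add: inv_mult_group inv m_assoc)
  have "a \<otimes> (b \<otimes> (c \<otimes> a)) = (a \<otimes> (b \<otimes> c)) \<otimes> a" by (simp add: m_assoc)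
  also have "\<dots> = c \<otimes> b" unfolding 2 by (simp add: m_assoc r)
  finally show ?thesis
    by (intro relsH_eval) (simp_all add: m_assoc aa r 1 inv_mult_group inv)
qed

lemma (in group) pc18_imp_relsH:
  assumes [simp]: "f1 \<in> carrier G" "f2 \<in> carrier G" "f3 \<in> carrier G"
    and r: "f1 \<otimes> f1 = \<one>" "f2 \<otimes> (f2 \<otimes> f2) = \<one>" "f3 \<otimes> (f3 \<otimes> f3) = \<one>"
      "inv f1 \<otimes> (f2 \<otimes> f1) = f2 \<otimes> f2" "inv f1 \<otimes> (f3 \<otimes> f1) = f3 \<otimes> f3" "inv f2 \<otimes> (f3 \<otimes> f2) = f3"
  shows "\<forall>(u, v)\<in>relsH. word_eval G (case_genH f2 f3 \<one> f1) u = word_eval G (case_genH f2 f3 \<one> f1) v"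
proof -
  have inv: "inv f1 = f1" "inv f2 = f2 \<otimes> f2" "inv f3 = f3 \<otimes> f3"
    by (rule inv_equality; simp add: r m_assoc)+
  have "f2 \<otimes> f3 = f2 \<otimes> (inv f2 \<otimes> (f3 \<otimes> f2))" unfolding r(6) ..
  also have "\<dots> = f3 \<otimes> f2" by (simp flip: m_assoc)
  finally show ?thesis using r by (intro relsH_eval) (simp_all add: inv)
qed

lemma (in group) pc54_imp_relsH:
  assumes [simp]: "f1 \<in> carrier G" "f2 \<in> carrier G" "f3 \<in> carrier G" "f4 \<in> carrier G"
    and r: "f1 \<otimes> f1 = \<one>" "f2 \<otimes> (f2 \<otimes> f2) = \<one>" "f3 \<otimes> (f3 \<otimes> f3) = \<one>" "f4 \<otimes> (f4 \<otimes> f4) = \<one>"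
      "inv f1 \<otimes> (f2 \<otimes> f1) = f2 \<otimes> f2" "inv f1 \<otimes> (f3 \<otimes> f1) = f3 \<otimes> f3" "inv f1 \<otimes> (f4 \<otimes> f1) = f4"
      "inv f2 \<otimes> (f3 \<otimes> f2) = f3 \<otimes> f4" "inv f2 \<otimes> (f4 \<otimes> f2) = f4" "inv f3 \<otimes> (f4 \<otimes> f3) = f4"
  shows "\<forall>(u, v)\<in>relsH. word_eval G (case_genH f3 f2 f4 f1) u = word_eval G (case_genH f3 f2 f4 f1) v"
proof -
  have inv: "inv f1 = f1" "inv f2 = f2 \<otimes> f2" "inv f3 = f3 \<otimes> f3"
    by (rule inv_equality; simp add: r m_assoc)+
  have conj: "y \<otimes> x = x \<otimes> v" if "inv x \<otimes> (y \<otimes> x) = v" "x \<in> carrier G" "y \<in> carrier G" for x y v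
  proof -
    have "x \<otimes> v = x \<otimes> (inv x \<otimes> (y \<otimes> x))" using that by simp
    also have "\<dots> = y \<otimes> x" using that(2,3) by (simp flip: m_assoc)
    finally show ?thesis ..
  qed
  have c: "f4 \<otimes> f1 = f1 \<otimes> f4" "f4 \<otimes> f2 = f2 \<otimes> f4" "f4 \<otimes> f3 = f3 \<otimes> f4"
    using r by (auto intro: conj)
  have "f3 \<otimes> f2 = f2 \<otimes> (f3 \<otimes> f4)" using r by (auto intro: conj)
  also have "\<dots> = f4 \<otimes> (f2 \<otimes> f3)" by (metis assms(2-4) c(2,3) m_assoc)
  finally show ?thesis using r c by (intro relsH_eval) (simp_all add: inv)
qed

lemma relsH_hom:
  assumes "group K" and x: "x\<^sub>1 \<in> carrier K" "x\<^sub>2 \<in> carrier K" "z \<in> carrier K" "w \<in> carrier K"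
    and R: "\<forall>(u, v)\<in>relsH. word_eval K (case_genH x\<^sub>1 x\<^sub>2 z w) u = word_eval K (case_genH x\<^sub>1 x\<^sub>2 z w) v"
  obtains h where "group_hom H20 K h" "h \<xi>\<^sub>1 = x\<^sub>1" "h \<xi>\<^sub>2 = x\<^sub>2" "h z\<^sub>1\<^sub>2 = z" "h w\<^sub>H = w"
proof -
  interpret K: group K by fact
  have c: "range (case_genH x\<^sub>1 x\<^sub>2 z w) \<subseteq> carrier K" using x by (auto split: genH.split)
  show thesis
    by (rule that[of "pres_hom K (case_genH x\<^sub>1 x\<^sub>2 z w)"])
       (simp_all add: H20_def K.pres_hom_hom[OF c R] \<xi>\<^sub>1_def \<xi>\<^sub>2_def z\<^sub>1\<^sub>2_def w\<^sub>H_def K.pres_hom_letter[OF c R])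
qed

lemma hom_G20:
  obtains p where "group_hom H20 G20 p" "kernel H20 G20 p = Z\<^sub>1\<^sub>2" "p ` carrier H20 = carrier G20"
proof -
  define k where "k g = word_class relsG20 (letter g)" for g
  define a b c where abc: "a = k A20" "b = k B20" "c = k C20"
  interpret G: group G20 unfolding presentations by (rule group_presented_group)
  have [simp]: "a \<in> carrier G20" "b \<in> carrier G20" "c \<in> carrier G20"
    by (simp_all add: abc k_def presentations)
  have r: "\<forall>(u, v)\<in>relsG20. word_eval G20 k u = word_eval G20 k v"
    using presented_relations[of relsG20] by (simp add: k_def[abs_def] presentations)
  have r': "a \<otimes>\<^bsub>G20\<^esub> a = \<one>\<^bsub>G20\<^esub>" "b \<otimes>\<^bsub>G20\<^esub> b = \<one>\<^bsub>G20\<^esub>" "c \<otimes>\<^bsub>G20\<^esub> c = \<one>\<^bsub>G20\<^esub>"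
    "a \<otimes>\<^bsub>G20\<^esub> (b \<otimes>\<^bsub>G20\<^esub> (c \<otimes>\<^bsub>G20\<^esub> (a \<otimes>\<^bsub>G20\<^esub> (b \<otimes>\<^bsub>G20\<^esub> c)))) = \<one>\<^bsub>G20\<^esub>"
    "a \<otimes>\<^bsub>G20\<^esub> (b \<otimes>\<^bsub>G20\<^esub> (a \<otimes>\<^bsub>G20\<^esub> (b \<otimes>\<^bsub>G20\<^esub> (a \<otimes>\<^bsub>G20\<^esub> b)))) = \<one>\<^bsub>G20\<^esub>"
    "a \<otimes>\<^bsub>G20\<^esub> (c \<otimes>\<^bsub>G20\<^esub> (a \<otimes>\<^bsub>G20\<^esub> (c \<otimes>\<^bsub>G20\<^esub> (a \<otimes>\<^bsub>G20\<^esub> c)))) = \<one>\<^bsub>G20\<^esub>"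
    using r unfolding relsG20_def Let_def by (simp_all add: word_defs flip: abc)
  have R: "\<forall>(u, v)\<in>relsH. word_eval G20 (case_genH (a \<otimes>\<^bsub>G20\<^esub> b) (c \<otimes>\<^bsub>G20\<^esub> a) \<one>\<^bsub>G20\<^esub> a) u =
      word_eval G20 (case_genH (a \<otimes>\<^bsub>G20\<^esub> b) (c \<otimes>\<^bsub>G20\<^esub> a) \<one>\<^bsub>G20\<^esub> a) v"
    by (rule G.G20_imp_relsH) (use r' in simp_all)
  obtain p where p: "group_hom H20 G20 p" and pg: "p \<xi>\<^sub>1 = a \<otimes>\<^bsub>G20\<^esub> b" "p \<xi>\<^sub>2 = c \<otimes>\<^bsub>G20\<^esub> a"
      "p z\<^sub>1\<^sub>2 = \<one>\<^bsub>G20\<^esub>" "p w\<^sub>H = a"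
    by (rule relsH_hom[OF G.is_group _ _ _ _ R]) simp_all
  interpret p: group_hom H20 G20 p by (rule p)
  \<comment> \<open>Lifts of \<open>a\<close>, \<open>b = a(ab)\<close> and \<open>c = (ca)a\<close>, namely \<open>w\<close>, \<open>w \<xi>\<^sub>1\<close> and \<open>\<xi>\<^sub>2 w\<close>.\<close>
  define f where "f = case_gen20 (elemH 0 0 0 1) (elemH 0 (-1) 0 1) (elemH 0 0 1 1)"
  define e where "e = case_genH (letter A20 @ letter B20) (letter C20 @ letter A20) [] (letter A20)"
  have f: "f A20 = w\<^sub>H" "f B20 = w\<^sub>H \<otimes>\<^bsub>H20\<^esub> \<xi>\<^sub>1" "f C20 = \<xi>\<^sub>2 \<otimes>\<^bsub>H20\<^esub> w\<^sub>H"
    by (simp_all add: f_def elemH_gens elemH_calc)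
  note * = presented_hom_kernel[of relsH relsG20 p "Z\<^sub>1\<^sub>2" f e, folded H20_def presentations]
  have ker: "Z\<^sub>1\<^sub>2 \<subseteq> kernel H20 G20 p"
    unfolding Z\<^sub>1\<^sub>2_def by (rule H.generate_subgroup_incl[OF _ p.subgroup_kernel]) (simp add: kernel_def pg)
  have f_car: "range f \<subseteq> carrier H20"
    by (auto simp: f_def split: gen20.split)
  have rel: "\<forall>(u, v)\<in>relsG20. Z\<^sub>1\<^sub>2 #>\<^bsub>H20\<^esub> word_eval H20 f u = Z\<^sub>1\<^sub>2 #>\<^bsub>H20\<^esub> word_eval H20 f v"
    by (simp add: relsG20_def Let_def word_defs f_def elemH_gens elemH_calc Z12_coset_eq_iff)
  have pf: "p (f g) = word_class relsG20 (letter g)" for g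
    unfolding k_def[symmetric]
    by (cases g) (simp_all add: f pg flip: abc, simp_all add: r' G.m_assoc flip: G.m_assoc[of a a])
  have pe: "p (word_class relsH (letter g)) = word_class relsG20 (e g)" for g
    by (cases g)
      (simp_all add: pg[unfolded \<xi>\<^sub>1_def \<xi>\<^sub>2_def z\<^sub>1\<^sub>2_def w\<^sub>H_def] e_def abc k_def presentations mult_presented one_presented)
  have fe: "Z\<^sub>1\<^sub>2 #>\<^bsub>H20\<^esub> word_eval H20 f (e g) = Z\<^sub>1\<^sub>2 #>\<^bsub>H20\<^esub> word_class relsH (letter g)" for g
    by (cases g)
      (simp_all add: \<xi>\<^sub>1_def[symmetric] \<xi>\<^sub>2_def[symmetric] z\<^sub>1\<^sub>2_def[symmetric] w\<^sub>H_def[symmetric] e_def,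
       simp_all add: letter_def f_def elemH_gens elemH_calc Z12_coset_eq_iff)
  show thesis using that[OF p *[OF p Z12_normal ker f_car rel pf pe fe]] .
qed

lemma hom_SmallGroup_18_4:
  obtains p where "group_hom H20 SmallGroup_18_4 p" "kernel H20 SmallGroup_18_4 p = Z\<^sub>1\<^sub>2"
    "p ` carrier H20 = carrier SmallGroup_18_4"
proof -
  let ?P = SmallGroup_18_4
  define k where "k g = word_class rels18 (letter g)" for g
  interpret G: group ?P unfolding presentations by (rule group_presented_group)
  have [simp]: "k g \<in> carrier ?P" for g
    by (simp add: k_def presentations)
  have r: "\<forall>(u, v)\<in>rels18. word_eval ?P k u = word_eval ?P k v"
    using presented_relations[of rels18] by (simp add: k_def[abs_def] presentations)
  have R: "\<forall>(u, v)\<in>relsH. word_eval ?P (case_genH (k P2) (k P3) \<one>\<^bsub>?P\<^esub> (k P1)) u =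
      word_eval ?P (case_genH (k P2) (k P3) \<one>\<^bsub>?P\<^esub> (k P1)) v"
    by (rule G.pc18_imp_relsH) (use r in \<open>simp_all add: rels18_def Let_def word_defs\<close>)
  obtain p where p: "group_hom H20 ?P p" and pg: "p \<xi>\<^sub>1 = k P2" "p \<xi>\<^sub>2 = k P3"
      "p z\<^sub>1\<^sub>2 = \<one>\<^bsub>?P\<^esub>" "p w\<^sub>H = k P1"
    by (rule relsH_hom[OF G.is_group _ _ _ _ R]) simp_all
  interpret p: group_hom H20 ?P p by (rule p)
  define f where "f = case_pc3 w\<^sub>H \<xi>\<^sub>1 \<xi>\<^sub>2"
  define e where "e = case_genH (letter P2) (letter P3) [] (letter P1)"
  note * = presented_hom_kernel[of relsH rels18 p "Z\<^sub>1\<^sub>2" f e, folded H20_def presentations]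
  have ker: "Z\<^sub>1\<^sub>2 \<subseteq> kernel H20 ?P p"
    unfolding Z\<^sub>1\<^sub>2_def by (rule H.generate_subgroup_incl[OF _ p.subgroup_kernel]) (simp add: kernel_def pg)
  have f_car: "range f \<subseteq> carrier H20"
    by (auto simp: f_def split: pc3.split)
  have rel: "\<forall>(u, v)\<in>rels18. Z\<^sub>1\<^sub>2 #>\<^bsub>H20\<^esub> word_eval H20 f u = Z\<^sub>1\<^sub>2 #>\<^bsub>H20\<^esub> word_eval H20 f v"
    by (simp add: rels18_def Let_def word_defs f_def elemH_gens elemH_calc Z12_coset_eq_iff)
  have pf: "p (f g) = word_class rels18 (letter g)" for g
    unfolding k_def[symmetric] by (cases g) (simp_all add: f_def pg)
  have pe: "p (word_class relsH (letter g)) = word_class rels18 (e g)" for g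
    by (cases g)
      (simp_all add: pg[unfolded \<xi>\<^sub>1_def \<xi>\<^sub>2_def z\<^sub>1\<^sub>2_def w\<^sub>H_def] e_def k_def presentations one_presented)
  have fe: "Z\<^sub>1\<^sub>2 #>\<^bsub>H20\<^esub> word_eval H20 f (e g) = Z\<^sub>1\<^sub>2 #>\<^bsub>H20\<^esub> word_class relsH (letter g)" for g
    by (cases g)
      (simp_all add: \<xi>\<^sub>1_def[symmetric] \<xi>\<^sub>2_def[symmetric] z\<^sub>1\<^sub>2_def[symmetric] w\<^sub>H_def[symmetric] e_def,
       simp_all add: letter_def f_def elemH_gens elemH_calc Z12_coset_eq_iff)
  show thesis using that[OF p *[OF p Z12_normal ker f_car rel pf pe fe]] .
qed

text \<open>The generators correspond as \<open>f\<^sub>1 = w\<close>, \<open>f\<^sub>2 = \<xi>\<^sub>2\<close>, \<open>f\<^sub>3 = \<xi>\<^sub>1\<close>, \<open>f\<^sub>4 = z\<^sub>1\<^sub>2\<close>. The order of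
  \<open>\<xi>\<^sub>1\<close> and \<open>\<xi>\<^sub>2\<close> matters: \<open>\<xi>\<^sub>2\<^sup>-\<^sup>1 \<xi>\<^sub>1 \<xi>\<^sub>2 = \<xi>\<^sub>1 z\<^sub>1\<^sub>2\<close>, whereas \<open>\<xi>\<^sub>1\<^sup>-\<^sup>1 \<xi>\<^sub>2 \<xi>\<^sub>1 = \<xi>\<^sub>2 z\<^sub>1\<^sub>2\<^sup>-\<^sup>1\<close>.\<close>

lemma H20_iso_SmallGroup_54_8: "H20 \<cong> SmallGroup_54_8"
proof -
  let ?P = SmallGroup_54_8
  define k where "k g = word_class rels54 (letter g)" for g
  interpret G: group ?P unfolding presentations by (rule group_presented_group)
  have [simp]: "k g \<in> carrier ?P" for g
    by (simp add: k_def presentations)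
  have r: "\<forall>(u, v)\<in>rels54. word_eval ?P k u = word_eval ?P k v"
    using presented_relations[of rels54] by (simp add: k_def[abs_def] presentations)
  have R: "\<forall>(u, v)\<in>relsH. word_eval ?P (case_genH (k F3) (k F2) (k F4) (k F1)) u =
      word_eval ?P (case_genH (k F3) (k F2) (k F4) (k F1)) v"
    by (rule G.pc54_imp_relsH) (use r in \<open>simp_all add: rels54_def Let_def word_defs\<close>)
  obtain p where p: "group_hom H20 ?P p" and pg: "p \<xi>\<^sub>1 = k F3" "p \<xi>\<^sub>2 = k F2"
      "p z\<^sub>1\<^sub>2 = k F4" "p w\<^sub>H = k F1"
    by (rule relsH_hom[OF G.is_group _ _ _ _ R]) simp_all
  interpret p: group_hom H20 ?P p by (rule p)
  define f where "f = case_pc4 w\<^sub>H \<xi>\<^sub>2 \<xi>\<^sub>1 z\<^sub>1\<^sub>2"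
  define e where "e = case_genH (letter F3) (letter F2) (letter F4) (letter F1)"
  let ?N = "{\<one>\<^bsub>H20\<^esub>}"
  note * = presented_hom_kernel[of relsH rels54 p ?N f e, folded H20_def presentations]
  have ker: "?N \<subseteq> kernel H20 ?P p" by (simp add: kernel_def)
  have f_car: "range f \<subseteq> carrier H20"
    by (auto simp: f_def split: pc4.split)
  have "\<forall>(u, v)\<in>rels54. word_eval H20 f u = word_eval H20 f v"
    by (simp add: rels54_def Let_def word_defs f_def elemH_gens elemH_calc elemH_eq_iff)
  then have rel: "\<forall>(u, v)\<in>rels54. ?N #>\<^bsub>H20\<^esub> word_eval H20 f u = ?N #>\<^bsub>H20\<^esub> word_eval H20 f v"
    by fastforce
  have pf: "p (f g) = word_class rels54 (letter g)" for g
    unfolding k_def[symmetric] by (cases g) (simp_all add: f_def pg)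
  have pe: "p (word_class relsH (letter g)) = word_class rels54 (e g)" for g
    by (cases g)
      (simp_all add: pg[unfolded \<xi>\<^sub>1_def \<xi>\<^sub>2_def z\<^sub>1\<^sub>2_def w\<^sub>H_def] e_def k_def)
  have fe: "?N #>\<^bsub>H20\<^esub> word_eval H20 f (e g) = ?N #>\<^bsub>H20\<^esub> word_class relsH (letter g)" for g
    by (cases g)
      (simp_all add: \<xi>\<^sub>1_def[symmetric] \<xi>\<^sub>2_def[symmetric] z\<^sub>1\<^sub>2_def[symmetric] w\<^sub>H_def[symmetric] e_def,
       simp_all add: letter_def f_def)
  from *[OF p H.one_is_normal ker f_car rel pf pe fe]
  have "p \<in> iso H20 ?P"
    by (simp add: iso_iff p.inj_iff_trivial_ker)
  then show ?thesis by (rule is_isoI)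
qed

section \<open>Semidirect decompositions\<close>

lemma (in group) internal_semidirectI:
  assumes S: "subgroup S G" and N: "subgroup N G" "N \<subseteq> S" and K: "subgroup K G" "K \<subseteq> S"
    and conj: "\<And>s n. s \<in> S \<Longrightarrow> n \<in> N \<Longrightarrow> s \<otimes> n \<otimes> inv s \<in> N"
    and "N \<inter> K \<subseteq> {\<one>}" "S \<subseteq> N <#> K"
  shows "internal_semidirect G N K S"
proof -
  interpret S: group "G\<lparr>carrier := S\<rparr>" by (rule subgroup_imp_group[OF S])
  have sub: "subgroup N (G\<lparr>carrier := S\<rparr>)" "subgroup K (G\<lparr>carrier := S\<rparr>)"
    using N K S by (auto intro: subgroup_incl)
  have "N \<lhd> G\<lparr>carrier := S\<rparr>"
    by (rule S.normal_invI[OF sub(1)]) (simp add: m_inv_consistent[OF S] conj)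
  moreover have "N <#> K \<subseteq> S"
    using N K subgroup.m_closed[OF S] by (auto simp: set_mult_def)
  moreover have "N \<inter> K = {\<one>}"
    using assms(7) subgroup.one_closed[OF N(1)] subgroup.one_closed[OF K(1)] by blast
  ultimately show ?thesis using assms sub by (auto simp: internal_semidirect_def)
qed

text \<open>The subgroups \<open>\<langle>\<xi>\<^sub>1, z\<^sub>1\<^sub>2\<rangle>\<close> and \<open>\<langle>\<xi>\<^sub>1, \<xi>\<^sub>2, z\<^sub>1\<^sub>2\<rangle>\<close> (the latter is the Heisenberg group of
  order 27), given by their normal forms.\<close>

definition N1 :: "genH word set set" where "N1 = range (\<lambda>(b, c). elemH b c 0 0)"
definition N2 :: "genH word set set" where "N2 = range (\<lambda>(b, c, d). elemH b c d 0)"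

lemma N_mem [simp]: "elemH b c 0 0 \<in> N1" "elemH b c d 0 \<in> N2"
  by (auto simp: N1_def N2_def)

lemma N_cases:
  "x \<in> N1 \<Longrightarrow> (\<And>b c. x = elemH b c 0 0 \<Longrightarrow> thesis) \<Longrightarrow> thesis"
  "x \<in> N2 \<Longrightarrow> (\<And>b c d. x = elemH b c d 0 \<Longrightarrow> thesis) \<Longrightarrow> thesis"
  by (auto simp: N1_def N2_def)

lemma N1_subgroup: "subgroup N1 H20" and N2_subgroup: "subgroup N2 H20"
  unfolding N1_def N2_def by (rule H.subgroupI; force simp: elemH_calc)+

lemma N1_direct: "internal_direct H20 \<Xi>\<^sub>1 Z\<^sub>1\<^sub>2 N1"
proof -
  have sub: "\<Xi>\<^sub>1 \<subseteq> N1" "Z\<^sub>1\<^sub>2 \<subseteq> N1" by (auto simp: N1_def Xi1_eq Z12_eq)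
  have conj1: "s \<otimes>\<^bsub>H20\<^esub> n \<otimes>\<^bsub>H20\<^esub> inv\<^bsub>H20\<^esub> s \<in> \<Xi>\<^sub>1" if "s \<in> N1" "n \<in> \<Xi>\<^sub>1" for s n
    using that by (auto simp: N1_def Xi1_eq elemH_calc)
  have "s \<otimes>\<^bsub>H20\<^esub> n \<otimes>\<^bsub>H20\<^esub> inv\<^bsub>H20\<^esub> s \<in> Z\<^sub>1\<^sub>2" if "s \<in> N1" "n \<in> Z\<^sub>1\<^sub>2" for s n
    using that by (auto simp: N1_def Z12_eq elemH_calc)
  moreover have "\<Xi>\<^sub>1 \<inter> Z\<^sub>1\<^sub>2 \<subseteq> {\<one>\<^bsub>H20\<^esub>}"
  proof
    fix x assume "x \<in> \<Xi>\<^sub>1 \<inter> Z\<^sub>1\<^sub>2"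
    then obtain k l where "x = elemH 0 k 0 0" "elemH 0 k 0 0 = elemH l 0 0 0"
      by (auto simp: Xi1_eq Z12_eq)
    then show "x \<in> {\<one>\<^bsub>H20\<^esub>}" by (simp add: elemH_gens elemH_eq_iff)
  qed
  moreover have "N1 \<subseteq> \<Xi>\<^sub>1 <#>\<^bsub>H20\<^esub> Z\<^sub>1\<^sub>2" "N1 \<subseteq> Z\<^sub>1\<^sub>2 <#>\<^bsub>H20\<^esub> \<Xi>\<^sub>1"
    by (force simp: N1_def Xi1_eq Z12_eq set_mult_def elemH_calc)+
  ultimately have "internal_semidirect H20 \<Xi>\<^sub>1 Z\<^sub>1\<^sub>2 N1" "internal_semidirect H20 Z\<^sub>1\<^sub>2 \<Xi>\<^sub>1 N1"
    by (intro H.internal_semidirectI N1_subgroup subgroups_H20 sub conj1; blast)+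
  then show ?thesis by (simp add: internal_direct_def internal_semidirect_def)
qed

lemma N2_semidirect: "internal_semidirect H20 N1 \<Xi>\<^sub>2 N2"
proof (intro H.internal_semidirectI N1_subgroup N2_subgroup subgroups_H20)
  show "N1 \<subseteq> N2" "\<Xi>\<^sub>2 \<subseteq> N2" by (auto simp: N1_def N2_def Xi2_eq)
  show "s \<otimes>\<^bsub>H20\<^esub> n \<otimes>\<^bsub>H20\<^esub> inv\<^bsub>H20\<^esub> s \<in> N1" if "s \<in> N2" "n \<in> N1" for s n
    using that by (auto simp: elemH_calc elim!: N_cases)
  show "N1 \<inter> \<Xi>\<^sub>2 \<subseteq> {\<one>\<^bsub>H20\<^esub>}"
  proof
    fix x assume "x \<in> N1 \<inter> \<Xi>\<^sub>2"
    then obtain b c d where "x = elemH 0 0 d 0" "elemH b c 0 0 = elemH 0 0 d 0"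
      by (auto simp: N1_def Xi2_eq)
    then show "x \<in> {\<one>\<^bsub>H20\<^esub>}" by (simp add: elemH_gens elemH_eq_iff)
  qed
  show "N2 \<subseteq> N1 <#>\<^bsub>H20\<^esub> \<Xi>\<^sub>2"
    by (force simp: N1_def N2_def Xi2_eq set_mult_def elemH_calc)
qed

lemma H20_semidirect: "internal_semidirect H20 N2 W\<^sub>H (carrier H20)"
proof (intro H.internal_semidirectI N2_subgroup H.subgroup_self subgroups_H20)
  show "N2 \<subseteq> carrier H20" "W\<^sub>H \<subseteq> carrier H20" by (auto simp: N2_def W_eq)
  show "s \<otimes>\<^bsub>H20\<^esub> n \<otimes>\<^bsub>H20\<^esub> inv\<^bsub>H20\<^esub> s \<in> N2" if "s \<in> carrier H20" "n \<in> N2" for s n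
    using that(1)
  proof (rule elemH_exhaust)
    fix b c d t assume "s = elemH b c d t" "t \<in> {0, 1}"
    \<comment> \<open>Conjugation by an element with \<open>t = 1\<close> produces the exponent \<open>1 + 1\<close> of \<open>w\<close>.\<close>
    moreover have "elemH b c d 2 = elemH b c d 0" for b c d by (simp add: elemH_eq_iff)
    ultimately show ?thesis using that(2) by (auto simp: elemH_calc elim!: N_cases)
  qed
  show "N2 \<inter> W\<^sub>H \<subseteq> {\<one>\<^bsub>H20\<^esub>}"
  proof
    fix x assume "x \<in> N2 \<inter> W\<^sub>H"
    then obtain b c d t where "x = elemH 0 0 0 t" "elemH b c d 0 = elemH 0 0 0 t"
      by (auto simp: N2_def W_eq)
    then show "x \<in> {\<one>\<^bsub>H20\<^esub>}" by (simp add: elemH_gens elemH_eq_iff)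
  qed
  show "carrier H20 \<subseteq> N2 <#>\<^bsub>H20\<^esub> W\<^sub>H"
  proof
    fix x assume "x \<in> carrier H20"
    then show "x \<in> N2 <#>\<^bsub>H20\<^esub> W\<^sub>H"
    proof (rule elemH_exhaust)
      fix b c d t assume "x = elemH b c d t"
      then have "x = elemH b c d 0 \<otimes>\<^bsub>H20\<^esub> elemH 0 0 0 t" by (simp add: elemH_calc)
      then show ?thesis by (auto simp: N2_def W_eq set_mult_def)
    qed
  qed
qed

lemma cyclic_iso:
  assumes hom: "\<And>k l. f (k + l) = f k \<otimes>\<^bsub>H20\<^esub> f l"
    and eq: "\<And>k l. f k = f l \<longleftrightarrow> k mod int n = l mod int n" and n: "n > 0"
  shows "H20\<lparr>carrier := range f\<rparr> \<cong> integer_mod_group n"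
proof -
  have mod: "f (k mod int n) = f k" for k by (simp add: eq)
  have "f k \<in> f ` {0..<int n}" for k
    by (rule image_eqI[of _ _ "k mod int n"]) (use n in \<open>simp_all add: mod\<close>)
  then have "f ` {0..<int n} = range f" by auto
  moreover have "inj_on f {0..<int n}" by (rule inj_onI) (simp add: eq)
  ultimately have "f \<in> iso (integer_mod_group n) (H20\<lparr>carrier := range f\<rparr>)"
    using n by (auto simp: iso_iff hom_def carrier_integer_mod_group mod hom)
  then show ?thesis by (rule group.iso_sym[OF group_integer_mod_group is_isoI])
qed

lemma cyclic_factors:
  "H20\<lparr>carrier := \<Xi>\<^sub>1\<rparr> \<cong> integer_mod_group 3" "H20\<lparr>carrier := Z\<^sub>1\<^sub>2\<rparr> \<cong> integer_mod_group 3"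
  "H20\<lparr>carrier := \<Xi>\<^sub>2\<rparr> \<cong> integer_mod_group 3" "H20\<lparr>carrier := W\<^sub>H\<rparr> \<cong> integer_mod_group 2"
  unfolding Xi1_eq Z12_eq Xi2_eq W_eq
     apply (rule cyclic_iso; simp add: elemH_calc elemH_eq_iff)
    apply (rule cyclic_iso; simp add: elemH_calc elemH_eq_iff)
   apply (rule cyclic_iso; simp add: elemH_calc elemH_eq_iff)
  apply (rule cyclic_iso)
    apply (simp only: elemH_pow(4)[symmetric] H.int_pow_mult gensH_carrier)
   apply (simp_all add: elemH_eq_iff)
  done

text \<open>An action by endomorphisms is a homomorphism to the automorphism group. Automorphisms in
  \<open>AutoGroup N\<close> are extensional, hence the restriction.\<close>

lemma action_hom_AutoGroup:
  assumes "group K" and hom: "\<And>k. k \<in> carrier K \<Longrightarrow> \<Phi> k \<in> hom N N"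
    and one: "\<And>n. n \<in> carrier N \<Longrightarrow> \<Phi> \<one>\<^bsub>K\<^esub> n = n"
    and mult: "\<And>k l n. k \<in> carrier K \<Longrightarrow> l \<in> carrier K \<Longrightarrow> n \<in> carrier N \<Longrightarrow>
      \<Phi> (k \<otimes>\<^bsub>K\<^esub> l) n = \<Phi> k (\<Phi> l n)"
    and closed: "\<And>m n. m \<in> carrier N \<Longrightarrow> n \<in> carrier N \<Longrightarrow> m \<otimes>\<^bsub>N\<^esub> n \<in> carrier N"
  shows "(\<lambda>k. restrict (\<Phi> k) (carrier N)) \<in> hom K (AutoGroup N)"
proof -
  interpret K: group K by fact
  have cl: "\<Phi> k n \<in> carrier N" if "k \<in> carrier K" "n \<in> carrier N" for k n
    using hom_in_carrier[OF hom] that by blast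
  have bij: "restrict (\<Phi> k) (carrier N) \<in> Bij (carrier N)" if k: "k \<in> carrier K" for k
  proof -
    have "bij_betw (\<Phi> k) (carrier N) (carrier N)"
      by (rule bij_betw_byWitness[where f' = "\<Phi> (inv\<^bsub>K\<^esub> k)"])
         (auto simp: k cl one simp flip: mult)
    then show ?thesis by (simp add: Bij_def)
  qed
  have "restrict (\<Phi> k) (carrier N) \<in> hom N N" if "k \<in> carrier K" for k
    using hom[OF that] by (auto simp: hom_def closed)
  with bij have auto: "restrict (\<Phi> k) (carrier N) \<in> auto N" if "k \<in> carrier K" for k
    using that by (simp add: auto_def)
  show ?thesis
  proof (rule homI)
    show "restrict (\<Phi> (k \<otimes>\<^bsub>K\<^esub> l)) (carrier N) =
        restrict (\<Phi> k) (carrier N) \<otimes>\<^bsub>AutoGroup N\<^esub> restrict (\<Phi> l) (carrier N)"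
      if "k \<in> carrier K" "l \<in> carrier K" for k l
      using that by (auto simp: AutoGroup_def BijGroup_def bij compose_def mult cl)
  qed (simp add: AutoGroup_def auto)
qed

text \<open>The structure \<open>G\<close> is only assumed to be closed under multiplication, so that this applies to a
  semidirect product before it is known to be a group.\<close>

lemma bij_hom_imp_iso:
  assumes h: "h \<in> hom G H" "bij_betw h (carrier G) (carrier H)"
    and closed: "\<And>x y. x \<in> carrier G \<Longrightarrow> y \<in> carrier G \<Longrightarrow> x \<otimes>\<^bsub>G\<^esub> y \<in> carrier G"
  shows "H \<cong> G"
proof -
  let ?k = "inv_into (carrier G) h"
  have b: "bij_betw ?k (carrier H) (carrier G)" by (rule bij_betw_inv_into[OF h(2)])
  have "?k (x \<otimes>\<^bsub>H\<^esub> y) = ?k x \<otimes>\<^bsub>G\<^esub> ?k y" if "x \<in> carrier H" "y \<in> carrier H" for x y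
  proof -
    have c: "?k x \<in> carrier G" "?k y \<in> carrier G" using bij_betwE[OF b] that by auto
    have "h (?k x \<otimes>\<^bsub>G\<^esub> ?k y) = x \<otimes>\<^bsub>H\<^esub> y"
      using c that h by (simp add: hom_mult bij_betw_inv_into_right[OF h(2)])
    with bij_betw_inv_into_left[OF h(2) closed[OF c]] show ?thesis by simp
  qed
  then have "?k \<in> iso H G" using b by (auto simp: iso_def hom_def dest: bij_betwE)
  then show ?thesis by (rule is_isoI)
qed

text \<open>Conjugation by \<open>\<xi>\<^sub>2^d\<close> on \<open>\<xi>\<^sub>1^c z\<^sub>1\<^sub>2^b\<close>, and by \<open>w^s\<close> on \<open>(\<xi>\<^sub>1^c z\<^sub>1\<^sub>2^b) \<xi>\<^sub>2^d\<close>, in exponents.\<close>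

definition act\<phi> :: "int \<Rightarrow> int \<times> int \<Rightarrow> int \<times> int" where
  "act\<phi> d = (\<lambda>(c, b). (c, (b - d * c) mod 3))"

definition act\<psi> :: "int \<Rightarrow> (int \<times> int) \<times> int \<Rightarrow> (int \<times> int) \<times> int" where
  "act\<psi> s = (\<lambda>((c, b), d). if s = 0 then ((c, b), d) else (((- c) mod 3, b), (- d) mod 3))"

lemma H20_external:
  "\<exists>\<phi> \<in> hom (integer_mod_group 3)
                 (AutoGroup (integer_mod_group 3 \<times>\<times> integer_mod_group 3)).
        let N = semidirect_product (integer_mod_group 3 \<times>\<times> integer_mod_group 3)
                  (integer_mod_group 3) \<phi>
        in \<exists>\<psi> \<in> hom (integer_mod_group 2) (AutoGroup N).
             H20 \<cong> semidirect_product N (integer_mod_group 2) \<psi>"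
proof -
  let ?Z3 = "integer_mod_group 3" and ?Z2 = "integer_mod_group 2"
  define M where "M = ?Z3 \<times>\<times> ?Z3"
  define \<phi> where "\<phi> = (\<lambda>d. restrict (act\<phi> d) (carrier M))"
  define N where "N = semidirect_product M ?Z3 \<phi>"
  define \<psi> where "\<psi> = (\<lambda>s. restrict (act\<psi> s) (carrier N))"
  define S where "S = semidirect_product N ?Z2 \<psi>"
  note car = carrier_integer_mod_group
  have cM: "carrier M = {0..<3} \<times> {0..<3}" by (simp add: M_def car)
  have cN: "carrier N = ({0..<3} \<times> {0..<3}) \<times> {0..<3}" by (simp add: N_def semidirect_product_def cM car)
  have cS: "carrier S = (({0..<3} \<times> {0..<3}) \<times> {0..<3}) \<times> {0..<2}"
    by (simp add: S_def semidirect_product_def cN car)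
  have mN: "((c, b), d) \<otimes>\<^bsub>N\<^esub> ((c', b'), d') =
      (((c + c') mod 3, (b + b' - d * c') mod 3), (d + d') mod 3)"
    if "((c', b'), d') \<in> carrier N" for c b d c' b' d'
    using that unfolding cN
    by (simp add: N_def semidirect_product_def \<phi>_def cM) (simp add: M_def act\<phi>_def mod_simps add_diff_eq)
  have mS: "(m, s) \<otimes>\<^bsub>S\<^esub> (n, t) = (m \<otimes>\<^bsub>N\<^esub> act\<psi> s n, (s + t) mod 2)"
    if "n \<in> carrier N" for m s n t
    using that by (simp add: S_def semidirect_product_def \<psi>_def)
  have clN: "m \<otimes>\<^bsub>N\<^esub> n \<in> carrier N" if "n \<in> carrier N" for m n
    using that by (cases m; cases n) (auto simp: mN, auto simp: cN)
  have act_cl: "act\<psi> s n \<in> carrier N" if "n \<in> carrier N" for s n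
    using that by (auto simp: cN act\<psi>_def)
  have *: "(b - d * (c mod 3)) mod 3 = (b - d * c) mod 3"
    "(b - (d mod 3) * c) mod 3 = (b - d * c) mod 3"
    "(b + (d mod 3) * c) mod 3 = (b + d * c) mod 3" for b c d :: int
    by (metis mod_diff_right_eq mod_mult_right_eq, metis mod_diff_right_eq mod_mult_left_eq,
        metis mod_add_right_eq mod_mult_left_eq)
  have hom\<phi>: "\<phi> \<in> hom ?Z3 (AutoGroup M)"
    unfolding \<phi>_def
  proof (rule action_hom_AutoGroup)
    show "act\<phi> d \<in> hom M M" for d
      by (auto simp: hom_def cM act\<phi>_def) (auto simp: M_def * mod_simps, simp add: algebra_simps)
    show "act\<phi> (d \<otimes>\<^bsub>?Z3\<^esub> e) n = act\<phi> d (act\<phi> e n)" for d e n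
      by (cases n) (simp add: act\<phi>_def * mod_simps, simp add: algebra_simps)
  qed (auto simp: cM act\<phi>_def, auto simp: M_def)
  have hom\<psi>: "\<psi> \<in> hom ?Z2 (AutoGroup N)"
    unfolding \<psi>_def
  proof (rule action_hom_AutoGroup)
    show "act\<psi> s \<in> hom N N" for s
    proof (rule homI)
      fix m n assume mn: "m \<in> carrier N" "n \<in> carrier N"
      obtain c b d c' b' d' where "m = ((c, b), d)" "n = ((c', b'), d')" by (metis prod.exhaust)
      with mn act_cl[OF mn(2), of s] show "act\<psi> s (m \<otimes>\<^bsub>N\<^esub> n) = act\<psi> s m \<otimes>\<^bsub>N\<^esub> act\<psi> s n"
        by (simp add: mN act\<psi>_def * mod_simps split: if_splits)
    qed (rule act_cl)
    show "act\<psi> (s \<otimes>\<^bsub>?Z2\<^esub> t) n = act\<psi> s (act\<psi> t n)"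
      if "s \<in> carrier ?Z2" "t \<in> carrier ?Z2" "n \<in> carrier N" for s t n
    proof -
      have "s = 0 \<or> s = 1" "t = 0 \<or> t = 1" using that by (auto simp: car)
      then show ?thesis using that(3) by (auto simp: cN act\<psi>_def mod_simps)
    qed
  qed (auto simp: clN act\<psi>_def)
  define h where "h = (\<lambda>(((c, b), d), s). elemH b c d s)"
  have hom: "h \<in> hom S H20"
  proof (rule homI)
    fix x y assume x: "x \<in> carrier S" and y: "y \<in> carrier S"
    obtain c b d s c' b' d' t where xy: "x = (((c, b), d), s)" "y = (((c', b'), d'), t)"
      by (metis prod.exhaust)
    have n: "((c', b'), d') \<in> carrier N" using y by (simp add: xy cS cN)
    have "s = 0 \<or> s = 1" using x by (auto simp: xy cS)
    then show "h (x \<otimes>\<^bsub>S\<^esub> y) = h x \<otimes>\<^bsub>H20\<^esub> h y"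
      using n act_cl[OF n, of s]
      by (elim disjE; simp add: xy mS h_def act\<psi>_def mN elemH_calc elemH_eq_iff mod_simps *)
  qed (auto simp: h_def)
  have "bij_betw (\<lambda>(((c, b), d), s). (b, c, d, s)) (carrier S)
      ({0..<3} \<times> {0..<3} \<times> {0..<3} \<times> {0..<2::int})"
    unfolding cS by (rule bij_betw_byWitness[where f' = "\<lambda>(b, c, d, s). (((c, b), d), s)"]) auto
  from bij_betw_trans[OF this elemH_bij]
  have bij: "bij_betw h (carrier S) (carrier H20)"
    by (simp add: h_def comp_def case_prod_unfold)
  have "H20 \<cong> S"
  proof (rule bij_hom_imp_iso[OF hom bij])
    fix x y assume x: "x \<in> carrier S" and y: "y \<in> carrier S"
    obtain m s n t where xy: "x = (m, s)" "y = (n, t)" by (metis prod.exhaust)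
    have n: "n \<in> carrier N" using y by (auto simp: xy cS cN)
    have "m \<otimes>\<^bsub>N\<^esub> act\<psi> s n \<in> carrier N" by (rule clN[OF act_cl[OF n]])
    then show "x \<otimes>\<^bsub>S\<^esub> y \<in> carrier S" by (simp add: xy mS[OF n] cS flip: cN)
  qed
  with hom\<phi> hom\<psi> show ?thesis unfolding Let_def S_def N_def M_def by blast
qed

section \<open>The second cohomology group\<close>

context group
begin

lemma cocycles2D:
  assumes "f \<in> carrier (cocycles2 G)"
  shows "x \<in> carrier G \<Longrightarrow> y \<in> carrier G \<Longrightarrow> f (x, y) \<noteq> 0"
    "x \<in> carrier G \<Longrightarrow> y \<in> carrier G \<Longrightarrow> z \<in> carrier G \<Longrightarrow>
       f (y, z) * f (x, y \<otimes> z) = f (x \<otimes> y, z) * f (x, y)"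
    "f \<in> extensional (carrier G \<times> carrier G)"
  using assms by (auto simp: cocycles2_def PiE_def Pi_iff)

lemma cocycles2I:
  assumes "\<And>x y. x \<in> carrier G \<Longrightarrow> y \<in> carrier G \<Longrightarrow> f x y \<noteq> 0"
    "\<And>x y z. x \<in> carrier G \<Longrightarrow> y \<in> carrier G \<Longrightarrow> z \<in> carrier G \<Longrightarrow>
       f y z * f x (y \<otimes> z) = f (x \<otimes> y) z * f x y"
  shows "(\<lambda>(x, y)\<in>carrier G \<times> carrier G. f x y) \<in> carrier (cocycles2 G)"
  using assms by (auto simp: cocycles2_def)

lemma cocycles2_eqI:
  assumes "f \<in> extensional (carrier G \<times> carrier G)" "g \<in> extensional (carrier G \<times> carrier G)"
    and "\<And>x y. x \<in> carrier G \<Longrightarrow> y \<in> carrier G \<Longrightarrow> f (x, y) = g (x, y)"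
  shows "f = g"
  by (rule extensionalityI[OF assms(1,2)]) (use assms(3) in auto)

lemma cocycles2_mult [simp]:
  "x \<in> carrier G \<Longrightarrow> y \<in> carrier G \<Longrightarrow> (f \<otimes>\<^bsub>cocycles2 G\<^esub> g) (x, y) = f (x, y) * g (x, y)"
  "f \<otimes>\<^bsub>cocycles2 G\<^esub> g \<in> extensional (carrier G \<times> carrier G)"
  by (auto simp: cocycles2_def)

lemma cocycles2_one [simp]:
  "x \<in> carrier G \<Longrightarrow> y \<in> carrier G \<Longrightarrow> \<one>\<^bsub>cocycles2 G\<^esub> (x, y) = 1"
  "\<one>\<^bsub>cocycles2 G\<^esub> \<in> extensional (carrier G \<times> carrier G)"
  by (auto simp: cocycles2_def)

lemma comm_group_cocycles2: "comm_group (cocycles2 G)"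
proof (rule comm_groupI)
  show "\<one>\<^bsub>cocycles2 G\<^esub> \<in> carrier (cocycles2 G)" by (auto simp: cocycles2_def)
next
  fix f g assume fg: "f \<in> carrier (cocycles2 G)" "g \<in> carrier (cocycles2 G)"
  have "f (y, z) * g (y, z) * (f (x, y \<otimes> z) * g (x, y \<otimes> z)) =
      f (x \<otimes> y, z) * g (x \<otimes> y, z) * (f (x, y) * g (x, y))"
    if "x \<in> carrier G" "y \<in> carrier G" "z \<in> carrier G" for x y z
    using arg_cong2[of _ _ _ _ "(*)", OF cocycles2D(2)[OF fg(1) that] cocycles2D(2)[OF fg(2) that]]
    by (simp only: mult_ac)
  then show "f \<otimes>\<^bsub>cocycles2 G\<^esub> g \<in> carrier (cocycles2 G)"
    using fg by (auto simp: cocycles2_def)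
  show "f \<otimes>\<^bsub>cocycles2 G\<^esub> g = g \<otimes>\<^bsub>cocycles2 G\<^esub> f"
    by (rule cocycles2_eqI) simp_all
next
  fix f g h
  show "f \<otimes>\<^bsub>cocycles2 G\<^esub> g \<otimes>\<^bsub>cocycles2 G\<^esub> h = f \<otimes>\<^bsub>cocycles2 G\<^esub> (g \<otimes>\<^bsub>cocycles2 G\<^esub> h)"
    by (rule cocycles2_eqI) simp_all
next
  fix f assume f: "f \<in> carrier (cocycles2 G)"
  show "\<one>\<^bsub>cocycles2 G\<^esub> \<otimes>\<^bsub>cocycles2 G\<^esub> f = f"
    by (rule cocycles2_eqI) (simp_all add: cocycles2D[OF f])
  let ?g = "\<lambda>(x, y)\<in>carrier G \<times> carrier G. inverse (f (x, y))"
  have "?g \<in> carrier (cocycles2 G)"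
    by (rule cocycles2I) (simp_all add: cocycles2D[OF f] flip: inverse_mult_distrib)
  moreover have "?g \<otimes>\<^bsub>cocycles2 G\<^esub> f = \<one>\<^bsub>cocycles2 G\<^esub>"
    by (rule cocycles2_eqI) (simp_all add: cocycles2D[OF f])
  ultimately show "\<exists>g\<in>carrier (cocycles2 G). g \<otimes>\<^bsub>cocycles2 G\<^esub> f = \<one>\<^bsub>cocycles2 G\<^esub>" by blast
qed

lemma coboundaries2_normal: "coboundaries2 G \<lhd> cocycles2 G"
proof -
  interpret Z: comm_group "cocycles2 G" by (rule comm_group_cocycles2)
  define \<delta> where "\<delta> c = (\<lambda>(x, y)\<in>carrier G \<times> carrier G. c x * c y / c (x \<otimes> y))" for c :: "'a \<Rightarrow> complex"
  have B: "coboundaries2 G = \<delta> ` (carrier G \<rightarrow> - {0})"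
    by (simp add: coboundaries2_def \<delta>_def)
  have \<delta>: "\<delta> c \<in> carrier (cocycles2 G)" if "c \<in> carrier G \<rightarrow> - {0}" for c
    unfolding \<delta>_def using that by (intro cocycles2I) (auto simp: Pi_iff m_assoc)
  have mult: "\<delta> c \<otimes>\<^bsub>cocycles2 G\<^esub> \<delta> d = \<delta> (\<lambda>x. c x * d x)" for c d
    by (rule cocycles2_eqI) (auto simp: \<delta>_def)
  have "subgroup (coboundaries2 G) (cocycles2 G)"
  proof (rule Z.subgroupI)
    show "coboundaries2 G \<subseteq> carrier (cocycles2 G)" unfolding B using \<delta> by blast
    have "(\<lambda>_. 1) \<in> carrier G \<rightarrow> - {0::complex}" by simp
    then show "coboundaries2 G \<noteq> {}" unfolding B by blast
    show "f \<otimes>\<^bsub>cocycles2 G\<^esub> g \<in> coboundaries2 G"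
      if "f \<in> coboundaries2 G" "g \<in> coboundaries2 G" for f g
      using that unfolding B by (auto simp: mult Pi_iff intro!: imageI)
    fix f assume "f \<in> coboundaries2 G"
    then obtain c where c: "f = \<delta> c" "c \<in> carrier G \<rightarrow> - {0}" unfolding B by blast
    have c': "(\<lambda>x. inverse (c x)) \<in> carrier G \<rightarrow> - {0}" using c(2) by auto
    have "\<delta> (\<lambda>x. inverse (c x)) \<otimes>\<^bsub>cocycles2 G\<^esub> \<delta> c = \<one>\<^bsub>cocycles2 G\<^esub>"
      using c(2) by (intro cocycles2_eqI) (auto simp: \<delta>_def Pi_iff field_simps)
    then have "inv\<^bsub>cocycles2 G\<^esub> f = \<delta> (\<lambda>x. inverse (c x))"
      using \<delta> c c' by (intro Z.inv_equality) auto
    then show "inv\<^bsub>cocycles2 G\<^esub> f \<in> coboundaries2 G" unfolding B using c' by blast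
  qed
  then show ?thesis by (rule Z.subgroup_imp_normal)
qed

end

text \<open>
  The central extension of \<open>G\<close> by \<open>\<complex>\<^sup>\<times>\<close> with factor set \<open>f\<close>. Cocycles need not be normalized, so
  the unit is \<open>(1 / f (1, 1), 1)\<close>.
\<close>

definition cocycle_extension :: "('a, 'm) monoid_scheme \<Rightarrow> ('a \<times> 'a \<Rightarrow> complex) \<Rightarrow> (complex \<times> 'a) monoid" where
  "cocycle_extension G f =
     \<lparr>carrier = (- {0}) \<times> carrier G,
      mult = (\<lambda>(a, x) (b, y). (a * b * f (x, y), x \<otimes>\<^bsub>G\<^esub> y)),
      one = (1 / f (\<one>\<^bsub>G\<^esub>, \<one>\<^bsub>G\<^esub>), \<one>\<^bsub>G\<^esub>)\<rparr>"

lemma cocycle_extension_simps [simp]: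
  "(a, x) \<in> carrier (cocycle_extension G f) \<longleftrightarrow> a \<noteq> 0 \<and> x \<in> carrier G"
  "(a, x) \<otimes>\<^bsub>cocycle_extension G f\<^esub> (b, y) = (a * b * f (x, y), x \<otimes>\<^bsub>G\<^esub> y)"
  "\<one>\<^bsub>cocycle_extension G f\<^esub> = (1 / f (\<one>\<^bsub>G\<^esub>, \<one>\<^bsub>G\<^esub>), \<one>\<^bsub>G\<^esub>)"
  by (simp_all add: cocycle_extension_def)

context group
begin

lemma cocycles2_normalized:
  assumes f: "f \<in> carrier (cocycles2 G)" and x: "x \<in> carrier G"
  shows "f (\<one>, x) = f (\<one>, \<one>)" "f (x, \<one>) = f (\<one>, \<one>)"
  using cocycles2D(2)[OF f one_closed one_closed x] cocycles2D(2)[OF f x one_closed one_closed]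
    cocycles2D(1)[OF f] x by simp_all

lemma cocycle_extension_hom:
  assumes f: "f \<in> carrier (cocycles2 G)"
  shows "group_hom (cocycle_extension G f) G snd"
proof -
  let ?E = "cocycle_extension G f"
  note nz = cocycles2D(1)[OF f] and norm = cocycles2_normalized[OF f]
  have "group ?E"
  proof (rule groupI)
    show "x \<otimes>\<^bsub>?E\<^esub> y \<in> carrier ?E" if "x \<in> carrier ?E" "y \<in> carrier ?E" for x y
      using that by (cases x; cases y) (simp add: nz)
    show "\<one>\<^bsub>?E\<^esub> \<in> carrier ?E" by (simp add: nz)
    show "x \<otimes>\<^bsub>?E\<^esub> y \<otimes>\<^bsub>?E\<^esub> z = x \<otimes>\<^bsub>?E\<^esub> (y \<otimes>\<^bsub>?E\<^esub> z)"
      if "x \<in> carrier ?E" "y \<in> carrier ?E" "z \<in> carrier ?E" for x y z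
    proof -
      obtain a x' b y' c z' where e: "x = (a, x')" "y = (b, y')" "z = (c, z')"
        by (metis prod.exhaust)
      then have "f (y', z') * f (x', y' \<otimes> z') = f (x' \<otimes> y', z') * f (x', y')"
        using cocycles2D(2)[OF f] that by simp
      then have "a * b * c * (f (y', z') * f (x', y' \<otimes> z')) = a * b * c * (f (x' \<otimes> y', z') * f (x', y'))"
        by (rule arg_cong)
      then show ?thesis using that by (simp add: e m_assoc mult_ac)
    qed
    show "\<one>\<^bsub>?E\<^esub> \<otimes>\<^bsub>?E\<^esub> x = x" if "x \<in> carrier ?E" for x
    proof -
      obtain a x' where "x = (a, x')" by fastforce
      with that norm(1)[of x'] show ?thesis by (simp add: nz)
    qed
    show "\<exists>y\<in>carrier ?E. y \<otimes>\<^bsub>?E\<^esub> x = \<one>\<^bsub>?E\<^esub>" if "x \<in> carrier ?E" for x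
    proof -
      obtain a x' where e: "x = (a, x')" by fastforce
      with that show ?thesis
        by (intro bexI[of _ "(1 / (a * f (inv x', x') * f (\<one>, \<one>)), inv x')"])
          (simp_all add: nz field_simps)
    qed
  qed
  then show ?thesis
    by (intro group_hom.intro group_hom_axioms.intro is_group homI)
       (auto simp: cocycle_extension_def)
qed

lemma cocycle_extension_central:
  assumes f: "f \<in> carrier (cocycles2 G)"
  shows "kernel (cocycle_extension G f) G snd \<subseteq> center (cocycle_extension G f)"
proof
  fix d assume "d \<in> kernel (cocycle_extension G f) G snd"
  then obtain a where a: "d = (a, \<one>)" "a \<noteq> 0" by (cases d) (simp add: kernel_def)
  have "d \<otimes>\<^bsub>cocycle_extension G f\<^esub> x = x \<otimes>\<^bsub>cocycle_extension G f\<^esub> d"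
    if "x \<in> carrier (cocycle_extension G f)" for x
  proof -
    obtain b x' where "x = (b, x')" by fastforce
    with that cocycles2_normalized[OF f, of x'] show ?thesis by (simp add: a)
  qed
  then show "d \<in> center (cocycle_extension G f)" by (simp add: center_def a)
qed

lemma cocycle_extension_divisible:
  assumes f: "f \<in> carrier (cocycles2 G)" and d: "d \<in> kernel (cocycle_extension G f) G snd"
  obtains e where "e \<in> kernel (cocycle_extension G f) G snd" "e \<otimes>\<^bsub>cocycle_extension G f\<^esub> e = d"
proof -
  obtain a where a: "d = (a, \<one>)" "a \<noteq> 0" using d by (cases d) (simp add: kernel_def)
  have nz: "f (\<one>, \<one>) \<noteq> 0" by (simp add: cocycles2D(1)[OF f])
  let ?e = "(csqrt (a / f (\<one>, \<one>)), \<one>)"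
  have "csqrt (a / f (\<one>, \<one>)) * csqrt (a / f (\<one>, \<one>)) = a / f (\<one>, \<one>)"
    by (simp flip: power2_eq_square)
  then have "?e \<in> kernel (cocycle_extension G f) G snd"
    "?e \<otimes>\<^bsub>cocycle_extension G f\<^esub> ?e = d"
    using a nz by (simp_all add: kernel_def)
  then show thesis by (rule that)
qed

text \<open>Adjusting elements by a central subgroup \<open>D\<close> all of whose elements are squares in \<open>D\<close>, so that
  relations known modulo \<open>D\<close> hold exactly.\<close>

lemma central_lift_involution:
  assumes D: "subgroup D G" "D \<subseteq> center G" and div: "\<And>d. d \<in> D \<Longrightarrow> \<exists>e\<in>D. e \<otimes> e = d"
    and [simp]: "w \<in> carrier G" and ww: "w \<otimes> w \<in> D"
  obtains e where "e \<in> D" "(e \<otimes> w) \<otimes> (e \<otimes> w) = \<one>"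
proof -
  have "inv (w \<otimes> w) \<in> D" by (rule subgroup.m_inv_closed[OF D(1) ww])
  then obtain e where e: "e \<in> D" "e \<otimes> e = inv (w \<otimes> w)" using div by blast
  have "e \<in> center G" using e(1) D(2) by blast
  then have [simp]: "e \<in> carrier G" and c: "e \<otimes> w = w \<otimes> e" by (simp_all add: center_def)
  have "(e \<otimes> w) \<otimes> (e \<otimes> w) = (e \<otimes> w) \<otimes> (w \<otimes> e)" by (simp only: c)
  also have "\<dots> = e \<otimes> ((w \<otimes> w) \<otimes> e)" by (simp add: m_assoc)
  also have "(w \<otimes> w) \<otimes> e = e \<otimes> (w \<otimes> w)" using D(2) ww by (simp add: center_def subset_iff)
  also have "e \<otimes> (e \<otimes> (w \<otimes> w)) = (e \<otimes> e) \<otimes> (w \<otimes> w)" by (simp add: m_assoc)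
  also have "\<dots> = \<one>" by (simp add: e(2))
  finally show thesis using e(1) that by blast
qed

lemma central_lift_inverted:
  assumes D: "subgroup D G" "D \<subseteq> center G" and div: "\<And>d. d \<in> D \<Longrightarrow> \<exists>e\<in>D. e \<otimes> e = d"
    and [simp]: "w \<in> carrier G" "x \<in> carrier G" and ww: "w \<otimes> w = \<one>"
    and wx: "w \<otimes> (x \<otimes> (w \<otimes> x)) \<in> D" and x3: "x \<otimes> (x \<otimes> x) \<in> D"
  obtains e where "e \<in> D" "w \<otimes> ((e \<otimes> x) \<otimes> w) = inv (e \<otimes> x)"
    "(e \<otimes> x) \<otimes> ((e \<otimes> x) \<otimes> (e \<otimes> x)) = \<one>"
proof -
  have DG: "d \<in> carrier G" if "d \<in> D" for d using that D(2) by (auto simp: center_def)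
  have comm: "u \<otimes> d = d \<otimes> u" if "d \<in> D" "u \<in> carrier G" for d u
    using that D(2) by (auto simp: center_def)
  have lcomm: "u \<otimes> (d \<otimes> v) = d \<otimes> (u \<otimes> v)" if "d \<in> D" "u \<in> carrier G" "v \<in> carrier G" for d u v
    using that comm[OF that(1,2)] DG by (simp flip: m_assoc)
  have w2: "w \<otimes> (w \<otimes> u) = u" if "u \<in> carrier G" for u
    using that by (simp add: ww flip: m_assoc)
  let ?d = "w \<otimes> (x \<otimes> (w \<otimes> x))"
  \<comment> \<open>With \<open>y = e \<otimes> x\<close>, the element \<open>w\<close> inverts \<open>y\<close>. The cube \<open>a\<close> of \<open>y\<close> lies in \<open>D\<close>, so it is fixed
    by \<open>w\<close> and also inverted by \<open>w\<close>, i.e. its own inverse; hence \<open>a \<otimes> y\<close> has trivial cube and is still inverted by \<open>w\<close>.\<close>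
  obtain e where e: "e \<in> D" "e \<otimes> e = inv ?d"
    using div subgroup.m_inv_closed[OF D(1) wx] by blast
  have [simp]: "e \<in> carrier G" using e(1) by (rule DG)
  note le = lcomm[OF e(1)]
  define y where "y = e \<otimes> x"
  have [simp]: "y \<in> carrier G" by (simp add: y_def)
  have "w \<otimes> (y \<otimes> (w \<otimes> y)) = (e \<otimes> e) \<otimes> ?d"
    by (simp add: y_def m_assoc le[of w] le[of x])
  then have "w \<otimes> (y \<otimes> (w \<otimes> y)) = \<one>" by (simp add: e(2))
  then have y_inv: "w \<otimes> (y \<otimes> w) = inv y"
    by (intro inv_equality[symmetric]) (simp_all add: m_assoc)
  let ?a = "y \<otimes> (y \<otimes> y)"
  have "?a = e \<otimes> (e \<otimes> (e \<otimes> (x \<otimes> (x \<otimes> x))))"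
    by (simp add: y_def m_assoc le[of x])
  then have a: "?a \<in> D" using e(1) x3 subgroup.m_closed[OF D(1)] by simp
  have "w \<otimes> (?a \<otimes> w) = (w \<otimes> (y \<otimes> w)) \<otimes> ((w \<otimes> (y \<otimes> w)) \<otimes> (w \<otimes> (y \<otimes> w)))"
    by (simp add: m_assoc w2)
  also have "\<dots> = inv ?a" by (simp add: y_inv inv_mult_group m_assoc)
  also have "w \<otimes> (?a \<otimes> w) = ?a" using lcomm[OF a, of w w] by (simp add: ww)
  finally have a_inv: "inv ?a = ?a" ..
  have "?a \<otimes> ?a = inv ?a \<otimes> ?a" by (simp only: a_inv)
  then have aa: "?a \<otimes> ?a = \<one>" by simp
  have eq: "(?a \<otimes> e) \<otimes> x = ?a \<otimes> y" by (simp add: y_def m_assoc)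
  show thesis
  proof (rule that[of "?a \<otimes> e", unfolded eq])
    show "?a \<otimes> e \<in> D" by (rule subgroup.m_closed[OF D(1) a e(1)])
    have "w \<otimes> ((?a \<otimes> y) \<otimes> w) = ?a \<otimes> (w \<otimes> (y \<otimes> w))"
      using lcomm[OF a, of w "y \<otimes> w"] by (simp add: m_assoc)
    also have "\<dots> = inv y \<otimes> inv ?a" unfolding y_inv a_inv using comm[OF a, of "inv y"] by simp
    also have "\<dots> = inv (?a \<otimes> y)" by (rule inv_mult_group[symmetric]) simp_all
    finally show "w \<otimes> ((?a \<otimes> y) \<otimes> w) = inv (?a \<otimes> y)" .
    have "(?a \<otimes> y) \<otimes> ((?a \<otimes> y) \<otimes> (?a \<otimes> y)) = (?a \<otimes> ?a) \<otimes> (?a \<otimes> ?a)" by (simp add: m_assoc)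
    then show "(?a \<otimes> y) \<otimes> ((?a \<otimes> y) \<otimes> (?a \<otimes> y)) = \<one>" by (simp add: aa)
  qed
qed

text \<open>A central commutator of an element with an element of order dividing 3 has order dividing 3:
  if \<open>z\<close> is the commutator of \<open>x\<close> and \<open>y\<close>, then \<open>z \<otimes> y\<close> is the conjugate of \<open>y\<close> by \<open>x\<close>, and its cube
  is the cube of \<open>z\<close>.\<close>

lemma central_commutator:
  assumes D: "subgroup D G" "D \<subseteq> center G"
    and [simp]: "x \<in> carrier G" "y \<in> carrier G" and y3: "y \<otimes> (y \<otimes> y) = \<one>"
    and z: "x \<otimes> y \<otimes> inv x \<otimes> inv y \<in> D" (is "?z \<in> D")
  shows "?z \<otimes> (?z \<otimes> ?z) = \<one>" "x \<otimes> y = ?z \<otimes> (y \<otimes> x)"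
proof -
  define z where "z = ?z"
  have [simp]: "z \<in> carrier G" by (simp add: z_def)
  have comm: "u \<otimes> z = z \<otimes> u" if "u \<in> carrier G" for u
    using that D(2) z by (auto simp: center_def z_def)
  have lcomm: "u \<otimes> (z \<otimes> v) = z \<otimes> (u \<otimes> v)" if "u \<in> carrier G" "v \<in> carrier G" for u v
    using that comm[OF that(1)] by (simp flip: m_assoc)
  have zy: "z \<otimes> y = x \<otimes> (y \<otimes> inv x)" by (simp add: z_def m_assoc)
  have inv_cancel: "inv x \<otimes> (x \<otimes> u) = u" if "u \<in> carrier G" for u
    using that by (simp flip: m_assoc)
  have "(z \<otimes> y) \<otimes> ((z \<otimes> y) \<otimes> (z \<otimes> y)) = x \<otimes> ((y \<otimes> (y \<otimes> y)) \<otimes> inv x)"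
    unfolding zy by (simp add: m_assoc inv_cancel)
  also have "\<dots> = \<one>" by (simp add: y3)
  finally have "(z \<otimes> y) \<otimes> ((z \<otimes> y) \<otimes> (z \<otimes> y)) = \<one>" .
  also have "(z \<otimes> y) \<otimes> ((z \<otimes> y) \<otimes> (z \<otimes> y)) = z \<otimes> (z \<otimes> (z \<otimes> (y \<otimes> (y \<otimes> y))))"
    by (simp add: m_assoc lcomm[of y])
  finally show "?z \<otimes> (?z \<otimes> ?z) = \<one>" by (simp add: y3 flip: z_def)
  show "x \<otimes> y = ?z \<otimes> (y \<otimes> x)" by (simp add: m_assoc inv_cancel, simp flip: m_assoc)
qed

end

section \<open>Transgression in a central extension\<close>

text \<open>A surjective homomorphism \<open>\<pi>\<close> from \<open>H\<close> to \<open>G\<close> with central kernel, together with a section \<open>s\<close>,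
  which need not be a homomorphism.\<close>

locale central_extension = group_hom H G \<pi> for H (structure) and G (structure) and \<pi> +
  fixes s
  assumes s_closed [simp]: "x \<in> carrier G \<Longrightarrow> s x \<in> carrier H"
    and \<pi>_s [simp]: "x \<in> carrier G \<Longrightarrow> \<pi> (s x) = x"
    and kernel_central: "kernel H G \<pi> \<subseteq> center H"
begin

text \<open>The factor set of the section.\<close>

definition factor :: "'c \<Rightarrow> 'c \<Rightarrow> 'a" where
  "factor x y = s x \<otimes>\<^bsub>H\<^esub> s y \<otimes>\<^bsub>H\<^esub> inv\<^bsub>H\<^esub> s (x \<otimes>\<^bsub>G\<^esub> y)"

text \<open>The cocycle obtained from a character of the kernel.\<close>

definition transgress :: "('a \<Rightarrow> complex) \<Rightarrow> 'c \<times> 'c \<Rightarrow> complex" where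
  "transgress \<chi> = (\<lambda>(x, y)\<in>carrier G \<times> carrier G. \<chi> (factor x y))"

text \<open>Characters of the kernel with values in \<open>\<complex>\<^sup>\<times>\<close>. Values outside the kernel are irrelevant.\<close>

definition kernel_char :: "('a \<Rightarrow> complex) \<Rightarrow> bool" where
  "kernel_char \<chi> \<longleftrightarrow> (\<forall>a\<in>kernel H G \<pi>. \<chi> a \<noteq> 0) \<and>
     (\<forall>a\<in>kernel H G \<pi>. \<forall>b\<in>kernel H G \<pi>. \<chi> (a \<otimes>\<^bsub>H\<^esub> b) = \<chi> a * \<chi> b)"

lemma factor_kernel: "x \<in> carrier G \<Longrightarrow> y \<in> carrier G \<Longrightarrow> factor x y \<in> kernel H G \<pi>"
  by (simp add: factor_def kernel_def)

lemma kernelD: "a \<in> kernel H G \<pi> \<Longrightarrow> a \<in> carrier H"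
  "a \<in> kernel H G \<pi> \<Longrightarrow> h \<in> carrier H \<Longrightarrow> a \<otimes>\<^bsub>H\<^esub> h = h \<otimes>\<^bsub>H\<^esub> a"
  using kernel_central by (auto simp: kernel_def center_def)

lemma factor_closed [simp]: "x \<in> carrier G \<Longrightarrow> y \<in> carrier G \<Longrightarrow> factor x y \<in> carrier H"
  by (simp add: factor_def)

lemma s_mult:
  assumes "x \<in> carrier G" "y \<in> carrier G"
  shows "s x \<otimes>\<^bsub>H\<^esub> s y = factor x y \<otimes>\<^bsub>H\<^esub> s (x \<otimes>\<^bsub>G\<^esub> y)"
  using assms by (simp add: factor_def G.m_assoc)

lemma factor_cocycle:
  assumes [simp]: "x \<in> carrier G" "y \<in> carrier G" "z \<in> carrier G"
  shows "factor y z \<otimes>\<^bsub>H\<^esub> factor x (y \<otimes>\<^bsub>G\<^esub> z) = factor (x \<otimes>\<^bsub>G\<^esub> y) z \<otimes>\<^bsub>H\<^esub> factor x y"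
proof -
  let ?t = "s (x \<otimes>\<^bsub>G\<^esub> (y \<otimes>\<^bsub>G\<^esub> z))"
  have "(factor y z \<otimes>\<^bsub>H\<^esub> factor x (y \<otimes>\<^bsub>G\<^esub> z)) \<otimes>\<^bsub>H\<^esub> ?t = factor y z \<otimes>\<^bsub>H\<^esub> (s x \<otimes>\<^bsub>H\<^esub> s (y \<otimes>\<^bsub>G\<^esub> z))"
    by (simp add: G.m_assoc s_mult)
  also have "\<dots> = (factor y z \<otimes>\<^bsub>H\<^esub> s x) \<otimes>\<^bsub>H\<^esub> s (y \<otimes>\<^bsub>G\<^esub> z)" by (simp add: G.m_assoc)
  also have "factor y z \<otimes>\<^bsub>H\<^esub> s x = s x \<otimes>\<^bsub>H\<^esub> factor y z" by (simp add: kernelD(2) factor_kernel)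
  also have "s x \<otimes>\<^bsub>H\<^esub> factor y z \<otimes>\<^bsub>H\<^esub> s (y \<otimes>\<^bsub>G\<^esub> z) = s x \<otimes>\<^bsub>H\<^esub> (s y \<otimes>\<^bsub>H\<^esub> s z)"
    by (simp add: G.m_assoc s_mult)
  also have "\<dots> = (s x \<otimes>\<^bsub>H\<^esub> s y) \<otimes>\<^bsub>H\<^esub> s z" by (simp add: G.m_assoc)
  also have "\<dots> = factor x y \<otimes>\<^bsub>H\<^esub> (s (x \<otimes>\<^bsub>G\<^esub> y) \<otimes>\<^bsub>H\<^esub> s z)"
    by (simp add: G.m_assoc s_mult[of x y])
  also have "\<dots> = (factor x y \<otimes>\<^bsub>H\<^esub> factor (x \<otimes>\<^bsub>G\<^esub> y) z) \<otimes>\<^bsub>H\<^esub> ?t"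
    by (simp add: G.m_assoc s_mult[of "x \<otimes>\<^bsub>G\<^esub> y" z] H.m_assoc)
  finally have "factor y z \<otimes>\<^bsub>H\<^esub> factor x (y \<otimes>\<^bsub>G\<^esub> z) = factor x y \<otimes>\<^bsub>H\<^esub> factor (x \<otimes>\<^bsub>G\<^esub> y) z"
    by (subst (asm) G.right_cancel) simp_all
  also have "\<dots> = factor (x \<otimes>\<^bsub>G\<^esub> y) z \<otimes>\<^bsub>H\<^esub> factor x y" by (simp add: kernelD(2) factor_kernel)
  finally show ?thesis .
qed

lemma transgress_cocycle:
  assumes "kernel_char \<chi>"
  shows "transgress \<chi> \<in> carrier (cocycles2 G)"
  unfolding transgress_def
proof (rule H.cocycles2I)
  have mult: "\<chi> (a \<otimes>\<^bsub>H\<^esub> b) = \<chi> a * \<chi> b" if "a \<in> kernel H G \<pi>" "b \<in> kernel H G \<pi>" for a b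
    using assms that by (simp add: kernel_char_def)
  show "\<chi> (factor x y) \<noteq> 0" if "x \<in> carrier G" "y \<in> carrier G" for x y
    using assms factor_kernel[OF that] by (simp add: kernel_char_def)
  show "\<chi> (factor y z) * \<chi> (factor x (y \<otimes>\<^bsub>G\<^esub> z)) = \<chi> (factor (x \<otimes>\<^bsub>G\<^esub> y) z) * \<chi> (factor x y)"
    if "x \<in> carrier G" "y \<in> carrier G" "z \<in> carrier G" for x y z
    using that by (simp add: factor_kernel factor_cocycle flip: mult)
qed

lemma transgress_mult:
  assumes "\<And>a. a \<in> kernel H G \<pi> \<Longrightarrow> \<chi> a = \<chi>\<^sub>1 a * \<chi>\<^sub>2 a"
  shows "transgress \<chi> = transgress \<chi>\<^sub>1 \<otimes>\<^bsub>cocycles2 G\<^esub> transgress \<chi>\<^sub>2"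
  by (rule H.cocycles2_eqI) (simp_all add: transgress_def assms factor_kernel)

text \<open>With \<open>x = \<pi> h\<close> and \<open>y = \<pi> k\<close>, the commutator of \<open>h\<close> and \<open>k\<close> is the quotient of the values of the
  factor set at \<open>(x, y)\<close> and \<open>(y, x)\<close>, while a coboundary takes equal values there.\<close>

lemma transgress_coboundary_imp_trivial:
  assumes \<chi>: "kernel_char \<chi>" and cob: "transgress \<chi> \<in> coboundaries2 G"
    and h: "h \<in> carrier H" and k: "k \<in> carrier H" and comm: "\<pi> h \<otimes>\<^bsub>G\<^esub> \<pi> k = \<pi> k \<otimes>\<^bsub>G\<^esub> \<pi> h"
  shows "\<chi> (h \<otimes>\<^bsub>H\<^esub> k \<otimes>\<^bsub>H\<^esub> inv\<^bsub>H\<^esub> h \<otimes>\<^bsub>H\<^esub> inv\<^bsub>H\<^esub> k) = 1"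
proof -
  have [simp]: "\<pi> h \<in> carrier G" "\<pi> k \<in> carrier G" using h k by simp_all
  let ?x = "\<pi> h" and ?y = "\<pi> k"
  obtain c where c: "transgress \<chi> = (\<lambda>(x, y)\<in>carrier G \<times> carrier G. c x * c y / c (x \<otimes>\<^bsub>G\<^esub> y))"
    using cob unfolding coboundaries2_def by blast
  have "transgress \<chi> (?x, ?y) = transgress \<chi> (?y, ?x)"
    unfolding c by (simp add: comm mult.commute)
  then have eq: "\<chi> (factor ?x ?y) = \<chi> (factor ?y ?x)" by (simp add: transgress_def)
  define a where "a = h \<otimes>\<^bsub>H\<^esub> inv\<^bsub>H\<^esub> s ?x"
  define b where "b = k \<otimes>\<^bsub>H\<^esub> inv\<^bsub>H\<^esub> s ?y"
  have a: "a \<in> kernel H G \<pi>" and b: "b \<in> kernel H G \<pi>"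
    using h k by (simp_all add: a_def b_def kernel_def)
  have ha: "h = a \<otimes>\<^bsub>H\<^esub> s ?x" and kb: "k = b \<otimes>\<^bsub>H\<^esub> s ?y"
    using h k by (simp_all add: a_def b_def G.m_assoc)
  have prod: "(a \<otimes>\<^bsub>H\<^esub> s x) \<otimes>\<^bsub>H\<^esub> (b \<otimes>\<^bsub>H\<^esub> s y) = (a \<otimes>\<^bsub>H\<^esub> b) \<otimes>\<^bsub>H\<^esub> (factor x y \<otimes>\<^bsub>H\<^esub> s (x \<otimes>\<^bsub>G\<^esub> y))"
    if "x \<in> carrier G" "y \<in> carrier G" "a \<in> kernel H G \<pi>" "b \<in> kernel H G \<pi>" for a b x y
  proof -
    have "s x \<otimes>\<^bsub>H\<^esub> (b \<otimes>\<^bsub>H\<^esub> s y) = b \<otimes>\<^bsub>H\<^esub> (s x \<otimes>\<^bsub>H\<^esub> s y)"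
      using that kernelD[OF that(4)] by (metis G.m_assoc s_closed)
    then show ?thesis using that kernelD(1) by (simp add: G.m_assoc s_mult)
  qed
  let ?c = "h \<otimes>\<^bsub>H\<^esub> k \<otimes>\<^bsub>H\<^esub> inv\<^bsub>H\<^esub> h \<otimes>\<^bsub>H\<^esub> inv\<^bsub>H\<^esub> k"
  have cH: "?c \<in> carrier H" using h k by simp
  have ck: "?c \<in> kernel H G \<pi>" using h k comm by (simp add: kernel_def H.m_assoc)
  let ?t = "s (?x \<otimes>\<^bsub>G\<^esub> ?y)"
  have "h \<otimes>\<^bsub>H\<^esub> k = ?c \<otimes>\<^bsub>H\<^esub> (k \<otimes>\<^bsub>H\<^esub> h)"
    using h k by (simp add: G.m_assoc) (simp flip: G.m_assoc)
  moreover have "h \<otimes>\<^bsub>H\<^esub> k = (a \<otimes>\<^bsub>H\<^esub> b) \<otimes>\<^bsub>H\<^esub> (factor ?x ?y \<otimes>\<^bsub>H\<^esub> ?t)"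
    using prod[OF _ _ a b, of ?x ?y] unfolding ha[symmetric] kb[symmetric] by simp
  moreover have "k \<otimes>\<^bsub>H\<^esub> h = (a \<otimes>\<^bsub>H\<^esub> b) \<otimes>\<^bsub>H\<^esub> (factor ?y ?x \<otimes>\<^bsub>H\<^esub> ?t)"
    using prod[OF _ _ b a, of ?y ?x]
    unfolding ha[symmetric] kb[symmetric] comm kernelD(2)[OF b kernelD(1)[OF a]] by simp
  ultimately have "(a \<otimes>\<^bsub>H\<^esub> b) \<otimes>\<^bsub>H\<^esub> (factor ?x ?y \<otimes>\<^bsub>H\<^esub> ?t) =
      ?c \<otimes>\<^bsub>H\<^esub> ((a \<otimes>\<^bsub>H\<^esub> b) \<otimes>\<^bsub>H\<^esub> (factor ?y ?x \<otimes>\<^bsub>H\<^esub> ?t))" by simp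
  also have "\<dots> = (?c \<otimes>\<^bsub>H\<^esub> (a \<otimes>\<^bsub>H\<^esub> b)) \<otimes>\<^bsub>H\<^esub> (factor ?y ?x \<otimes>\<^bsub>H\<^esub> ?t)"
    by (rule G.m_assoc[symmetric]) (simp_all add: kernelD(1) a b cH)
  also have "?c \<otimes>\<^bsub>H\<^esub> (a \<otimes>\<^bsub>H\<^esub> b) = (a \<otimes>\<^bsub>H\<^esub> b) \<otimes>\<^bsub>H\<^esub> ?c"
    by (rule kernelD(2)[OF ck]) (simp add: kernelD(1) a b)
  finally have "(a \<otimes>\<^bsub>H\<^esub> b) \<otimes>\<^bsub>H\<^esub> (factor ?x ?y \<otimes>\<^bsub>H\<^esub> ?t) =
      (a \<otimes>\<^bsub>H\<^esub> b) \<otimes>\<^bsub>H\<^esub> ((?c \<otimes>\<^bsub>H\<^esub> factor ?y ?x) \<otimes>\<^bsub>H\<^esub> ?t)"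
    by (simp only: G.m_assoc kernelD(1)[OF a] kernelD(1)[OF b] cH G.m_closed factor_closed s_closed
        H.m_closed \<open>\<pi> h \<in> carrier G\<close> \<open>\<pi> k \<in> carrier G\<close> h k G.inv_closed)
  then have "factor ?x ?y \<otimes>\<^bsub>H\<^esub> ?t = (?c \<otimes>\<^bsub>H\<^esub> factor ?y ?x) \<otimes>\<^bsub>H\<^esub> ?t"
    using G.Units_l_cancel[of "a \<otimes>\<^bsub>H\<^esub> b"] by (simp_all add: kernelD(1)[OF a] kernelD(1)[OF b] h k)
  then have "factor ?x ?y = ?c \<otimes>\<^bsub>H\<^esub> factor ?y ?x"
    by (subst (asm) G.right_cancel) (simp_all add: h k)
  with eq have "\<chi> (factor ?y ?x) = \<chi> (?c \<otimes>\<^bsub>H\<^esub> factor ?y ?x)" by simp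
  also have "\<dots> = \<chi> ?c * \<chi> (factor ?y ?x)"
    using \<chi> ck factor_kernel[OF \<open>\<pi> k \<in> carrier G\<close> \<open>\<pi> h \<in> carrier G\<close>]
    unfolding kernel_char_def by blast
  finally have "\<chi> (factor ?y ?x) = \<chi> ?c * \<chi> (factor ?y ?x)" .
  moreover have "\<chi> (factor ?y ?x) \<noteq> 0"
    using \<chi> factor_kernel[of ?y ?x] by (simp add: kernel_char_def)
  ultimately show ?thesis by simp
qed

text \<open>If \<open>\<pi>\<close> lifts to a homomorphism to the extension defined by \<open>f\<close>, then \<open>f\<close> is cohomologous to the
  transgression of the restriction of the lift to the kernel.\<close>

lemma cocycle_cohomologous_transgress:
  assumes f: "f \<in> carrier (cocycles2 G)"
    and \<phi>: "group_hom H (cocycle_extension G f) \<phi>" and snd\<phi>: "\<And>h. h \<in> carrier H \<Longrightarrow> snd (\<phi> h) = \<pi> h"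
  obtains \<chi> g where "kernel_char \<chi>" "g \<in> coboundaries2 G" "f = g \<otimes>\<^bsub>cocycles2 G\<^esub> transgress \<chi>"
proof -
  interpret \<phi>: group_hom H "cocycle_extension G f" \<phi> by (rule \<phi>)
  note nz = H.cocycles2D(1)[OF f] and norm = H.cocycles2_normalized[OF f]
  let ?f1 = "f (\<one>\<^bsub>G\<^esub>, \<one>\<^bsub>G\<^esub>)"
  have f1: "?f1 \<noteq> 0" by (simp add: nz)
  define u where "u x = fst (\<phi> (s x))" for x
  \<comment> \<open>The scalar \<open>\<lambda>\<close> is embedded in the extension as \<open>(\<lambda> / f (1, 1), 1)\<close>.\<close>
  define \<chi> where "\<chi> a = fst (\<phi> a) * ?f1" for a
  have fst: "fst (\<phi> h) \<noteq> 0" if "h \<in> carrier H" for h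
    using \<phi>.hom_closed[OF that] by (cases "\<phi> h") simp
  have \<phi>s: "\<phi> (s x) = (u x, x)" if "x \<in> carrier G" for x
    using snd\<phi>[of "s x"] that by (simp add: u_def prod_eq_iff)
  have u: "u x \<noteq> 0" if "x \<in> carrier G" for x using fst that by (simp add: u_def)
  have \<phi>a: "\<phi> a = (\<chi> a / ?f1, \<one>\<^bsub>G\<^esub>)" if "a \<in> kernel H G \<pi>" for a
    using snd\<phi>[of a] that f1 by (simp add: \<chi>_def prod_eq_iff kernel_def)
  have char: "kernel_char \<chi>"
    unfolding kernel_char_def
  proof (intro conjI ballI)
    show "\<chi> a \<noteq> 0" if "a \<in> kernel H G \<pi>" for a
      using fst[OF kernelD(1)[OF that]] f1 by (simp add: \<chi>_def)
    fix a b assume ab: "a \<in> kernel H G \<pi>" "b \<in> kernel H G \<pi>"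
    have abk: "a \<otimes>\<^bsub>H\<^esub> b \<in> kernel H G \<pi>" using ab by (simp add: kernel_def)
    have "\<phi> (a \<otimes>\<^bsub>H\<^esub> b) = \<phi> a \<otimes>\<^bsub>cocycle_extension G f\<^esub> \<phi> b"
      using ab kernelD(1) by simp
    then show "\<chi> (a \<otimes>\<^bsub>H\<^esub> b) = \<chi> a * \<chi> b"
      unfolding \<phi>a[OF ab(1)] \<phi>a[OF ab(2)] \<phi>a[OF abk] using f1 by simp
  qed
  have eq: "u x * u y * f (x, y) = \<chi> (factor x y) * u (x \<otimes>\<^bsub>G\<^esub> y)"
    if xy: "x \<in> carrier G" "y \<in> carrier G" for x y
  proof -
    have "\<phi> (s x) \<otimes>\<^bsub>cocycle_extension G f\<^esub> \<phi> (s y) = \<phi> (s x \<otimes>\<^bsub>H\<^esub> s y)" using xy by simp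
    also have "\<dots> = \<phi> (factor x y) \<otimes>\<^bsub>cocycle_extension G f\<^esub> \<phi> (s (x \<otimes>\<^bsub>G\<^esub> y))"
      unfolding s_mult[OF xy] using xy by simp
    finally show ?thesis
      using xy norm(1)[of "x \<otimes>\<^bsub>G\<^esub> y"] f1 by (simp add: \<phi>s \<phi>a factor_kernel)
  qed
  define g where "g = (\<lambda>(x, y)\<in>carrier G \<times> carrier G. inverse (u x) * inverse (u y) / inverse (u (x \<otimes>\<^bsub>G\<^esub> y)))"
  have "g \<in> coboundaries2 G"
    unfolding coboundaries2_def g_def using u by (intro imageI) auto
  moreover have "f = g \<otimes>\<^bsub>cocycles2 G\<^esub> transgress \<chi>"
  proof (rule H.cocycles2_eqI)
    fix x y assume xy: "x \<in> carrier G" "y \<in> carrier G"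
    then show "f (x, y) = (g \<otimes>\<^bsub>cocycles2 G\<^esub> transgress \<chi>) (x, y)"
      using eq[OF xy] u[OF xy(1)] u[OF xy(2)]
      by (simp add: g_def transgress_def field_simps)
  qed (simp_all add: H.cocycles2D(3)[OF f])
  ultimately show thesis using char that by blast
qed

end

section \<open>The Schur multiplier\<close>

text \<open>Every homomorphism from \<open>H20\<close> to \<open>G\<close> that is trivial on \<open>z\<^sub>1\<^sub>2\<close> lifts to each central extension
  of \<open>G\<close> by \<open>\<complex>\<^sup>\<times>\<close>.\<close>

lemma H20_hom_to_cocycle_extension:
  assumes p: "group_hom H20 G p" and f: "f \<in> carrier (cocycles2 G)"
    and z: "p z\<^sub>1\<^sub>2 = \<one>\<^bsub>G\<^esub>"
  obtains \<phi> where "group_hom H20 (cocycle_extension G f) \<phi>"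
    "\<And>h. h \<in> carrier H20 \<Longrightarrow> snd (\<phi> h) = p h"
proof -
  interpret p: group_hom H20 G p by (rule p)
  let ?E = "cocycle_extension G f"
  interpret q: group_hom ?E G snd by (rule p.H.cocycle_extension_hom[OF f])
  let ?D = "kernel ?E G snd"
  note D = q.subgroup_kernel p.H.cocycle_extension_central[OF f]
  have div: "\<exists>e\<in>?D. e \<otimes>\<^bsub>?E\<^esub> e = d" if "d \<in> ?D" for d
    using p.H.cocycle_extension_divisible[OF f that] by metis
  have DE: "d \<in> carrier ?E" "snd d = \<one>\<^bsub>G\<^esub>" if "d \<in> ?D" for d
    using that by (simp_all add: kernel_def)
  define x y w where "x = (1 :: complex, p \<xi>\<^sub>1)" and "y = (1 :: complex, p \<xi>\<^sub>2)" and "w = (1 :: complex, p w\<^sub>H)"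
  have [simp]: "x \<in> carrier ?E" "y \<in> carrier ?E" "w \<in> carrier ?E"
    and s: "snd x = p \<xi>\<^sub>1" "snd y = p \<xi>\<^sub>2" "snd w = p w\<^sub>H"
    by (simp_all add: x_def y_def w_def)
  have ww: "w \<otimes>\<^bsub>?E\<^esub> w \<in> ?D"
  proof -
    have "w\<^sub>H \<otimes>\<^bsub>H20\<^esub> w\<^sub>H = \<one>\<^bsub>H20\<^esub>" by (simp add: elemH_gens elemH_calc elemH_eq_iff)
    then have "p (w\<^sub>H \<otimes>\<^bsub>H20\<^esub> w\<^sub>H) = \<one>\<^bsub>G\<^esub>" by (simp only: p.hom_one)
    then show ?thesis by (simp add: kernel_def s)
  qed
  obtain e where e: "e \<in> ?D" "(e \<otimes>\<^bsub>?E\<^esub> w) \<otimes>\<^bsub>?E\<^esub> (e \<otimes>\<^bsub>?E\<^esub> w) = \<one>\<^bsub>?E\<^esub>"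
    by (rule q.G.central_lift_involution[OF D div _ ww]) simp_all
  define W where "W = e \<otimes>\<^bsub>?E\<^esub> w"
  have [simp]: "W \<in> carrier ?E" and sW: "snd W = p w\<^sub>H" and WW: "W \<otimes>\<^bsub>?E\<^esub> W = \<one>\<^bsub>?E\<^esub>"
    using e DE by (simp_all add: W_def s)
  have lift: "\<exists>X \<in> carrier ?E. snd X = p \<xi> \<and> W \<otimes>\<^bsub>?E\<^esub> (X \<otimes>\<^bsub>?E\<^esub> W) = inv\<^bsub>?E\<^esub> X \<and>
      X \<otimes>\<^bsub>?E\<^esub> (X \<otimes>\<^bsub>?E\<^esub> X) = \<one>\<^bsub>?E\<^esub>"
    if [simp]: "u \<in> carrier ?E" and u: "snd u = p \<xi>" and \<xi>: "\<xi> = \<xi>\<^sub>1 \<or> \<xi> = \<xi>\<^sub>2" for u \<xi>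
  proof -
    have [simp]: "\<xi> \<in> carrier H20" using \<xi> by auto
    have 1: "w\<^sub>H \<otimes>\<^bsub>H20\<^esub> (\<xi> \<otimes>\<^bsub>H20\<^esub> (w\<^sub>H \<otimes>\<^bsub>H20\<^esub> \<xi>)) = \<one>\<^bsub>H20\<^esub>" "\<xi> \<otimes>\<^bsub>H20\<^esub> (\<xi> \<otimes>\<^bsub>H20\<^esub> \<xi>) = \<one>\<^bsub>H20\<^esub>"
      using \<xi> by (elim disjE; simp add: elemH_gens elemH_calc elemH_eq_iff)+
    have "p (w\<^sub>H \<otimes>\<^bsub>H20\<^esub> (\<xi> \<otimes>\<^bsub>H20\<^esub> (w\<^sub>H \<otimes>\<^bsub>H20\<^esub> \<xi>))) = \<one>\<^bsub>G\<^esub>" "p (\<xi> \<otimes>\<^bsub>H20\<^esub> (\<xi> \<otimes>\<^bsub>H20\<^esub> \<xi>)) = \<one>\<^bsub>G\<^esub>"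
      unfolding 1 by simp_all
    then have "W \<otimes>\<^bsub>?E\<^esub> (u \<otimes>\<^bsub>?E\<^esub> (W \<otimes>\<^bsub>?E\<^esub> u)) \<in> ?D" "u \<otimes>\<^bsub>?E\<^esub> (u \<otimes>\<^bsub>?E\<^esub> u) \<in> ?D"
      by (simp_all add: kernel_def sW u)
    from q.G.central_lift_inverted[OF D div _ _ WW this]
    obtain d where d: "d \<in> ?D" "W \<otimes>\<^bsub>?E\<^esub> ((d \<otimes>\<^bsub>?E\<^esub> u) \<otimes>\<^bsub>?E\<^esub> W) = inv\<^bsub>?E\<^esub> (d \<otimes>\<^bsub>?E\<^esub> u)"
      "(d \<otimes>\<^bsub>?E\<^esub> u) \<otimes>\<^bsub>?E\<^esub> ((d \<otimes>\<^bsub>?E\<^esub> u) \<otimes>\<^bsub>?E\<^esub> (d \<otimes>\<^bsub>?E\<^esub> u)) = \<one>\<^bsub>?E\<^esub>" by auto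
    then show ?thesis using DE by (intro bexI[of _ "d \<otimes>\<^bsub>?E\<^esub> u"]) (simp_all add: u)
  qed
  obtain X where X [simp]: "X \<in> carrier ?E" and X': "snd X = p \<xi>\<^sub>1"
    "W \<otimes>\<^bsub>?E\<^esub> (X \<otimes>\<^bsub>?E\<^esub> W) = inv\<^bsub>?E\<^esub> X" "X \<otimes>\<^bsub>?E\<^esub> (X \<otimes>\<^bsub>?E\<^esub> X) = \<one>\<^bsub>?E\<^esub>"
    using lift[of x "\<xi>\<^sub>1"] s by auto
  obtain Y where Y [simp]: "Y \<in> carrier ?E" and Y': "snd Y = p \<xi>\<^sub>2"
    "W \<otimes>\<^bsub>?E\<^esub> (Y \<otimes>\<^bsub>?E\<^esub> W) = inv\<^bsub>?E\<^esub> Y" "Y \<otimes>\<^bsub>?E\<^esub> (Y \<otimes>\<^bsub>?E\<^esub> Y) = \<one>\<^bsub>?E\<^esub>"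
    using lift[of y "\<xi>\<^sub>2"] s by auto
  define Z where "Z = X \<otimes>\<^bsub>?E\<^esub> Y \<otimes>\<^bsub>?E\<^esub> inv\<^bsub>?E\<^esub> X \<otimes>\<^bsub>?E\<^esub> inv\<^bsub>?E\<^esub> Y"
  have "p (\<xi>\<^sub>1 \<otimes>\<^bsub>H20\<^esub> \<xi>\<^sub>2 \<otimes>\<^bsub>H20\<^esub> inv\<^bsub>H20\<^esub> \<xi>\<^sub>1 \<otimes>\<^bsub>H20\<^esub> inv\<^bsub>H20\<^esub> \<xi>\<^sub>2) = \<one>\<^bsub>G\<^esub>"
    unfolding commutator_xi[symmetric] by (rule z)
  then have ZD: "Z \<in> ?D" by (simp add: Z_def kernel_def X' Y')
  then have [simp]: "Z \<in> carrier ?E" and sZ: "snd Z = \<one>\<^bsub>G\<^esub>" using DE by auto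
  have comm: "Z \<otimes>\<^bsub>?E\<^esub> u = u \<otimes>\<^bsub>?E\<^esub> Z" if "u \<in> carrier ?E" for u
    using ZD D(2) that by (auto simp: center_def)
  note Z' = q.G.central_commutator[OF D X Y Y'(3) ZD[unfolded Z_def], folded Z_def]
  obtain \<phi> where \<phi>: "group_hom H20 ?E \<phi>" and \<phi>g: "\<phi> \<xi>\<^sub>1 = X" "\<phi> \<xi>\<^sub>2 = Y" "\<phi> z\<^sub>1\<^sub>2 = Z" "\<phi> w\<^sub>H = W"
    by (rule relsH_hom[OF q.G.is_group X Y _ _ q.G.relsH_eval[OF X Y _ _ X'(3) Y'(3) Z'(1) WW _ _ _ Z'(2) X'(2) Y'(2)]])
       (simp_all add: comm)
  have \<phi>': "group_hom H20 G (snd \<circ> \<phi>)"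
    using hom_compose[OF group_hom.homh[OF \<phi>] q.homh]
    by (intro group_hom.intro group_hom_axioms.intro H.is_group p.H.is_group)
  have gens: "(snd \<circ> \<phi>) (word_class relsH (letter g)) = p (word_class relsH (letter g))" for g
    by (cases g) (simp_all add: \<phi>g X' Y' sZ sW z flip: \<xi>\<^sub>1_def \<xi>\<^sub>2_def z\<^sub>1\<^sub>2_def w\<^sub>H_def)
  have "snd (\<phi> h) = p h" if "h \<in> carrier H20" for h
    using presented_hom_eqI[OF \<phi>'[unfolded H20_def] p[unfolded H20_def] gens] that
    by (simp add: H20_def)
  with \<phi> show thesis by (rule that)
qed

text \<open>The character of \<open>\<langle>z\<^sub>1\<^sub>2\<rangle>\<close> that maps \<open>z\<^sub>1\<^sub>2\<close> to \<open>\<zeta>\<close>, where \<open>\<zeta>\<^sup>3 = 1\<close>. Any exponent \<open>b\<close> may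
  be chosen, since exponents congruent modulo 3 give the same power of \<open>\<zeta>\<close>.\<close>

definition char_H :: "complex \<Rightarrow> genH word set \<Rightarrow> complex" where
  "char_H \<zeta> a = \<zeta> powi (SOME b. a = elemH b 0 0 0)"

lemma powi_mod_3:
  fixes \<zeta> :: complex
  assumes "\<zeta> ^ 3 = 1" "b mod 3 = c mod 3"
  shows "\<zeta> powi b = \<zeta> powi c"
proof -
  have nz: "\<zeta> \<noteq> 0" using assms(1) by auto
  have red: "\<zeta> powi b = \<zeta> powi (b mod 3)" for b
  proof -
    have "\<zeta> powi b = \<zeta> powi (3 * (b div 3) + b mod 3)" by simp
    also have "\<dots> = (\<zeta> powi 3) powi (b div 3) * \<zeta> powi (b mod 3)"
      using nz by (simp only: power_int_add power_int_mult simp_thms)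
    also have "\<zeta> powi 3 = 1" using assms(1) by simp
    finally show ?thesis by simp
  qed
  show ?thesis by (subst (1 2) red) (simp only: assms(2))
qed

lemma char_H_elemH:
  assumes "\<zeta> ^ 3 = 1"
  shows "char_H \<zeta> (elemH b 0 0 0) = \<zeta> powi b"
proof -
  define c where "c = (SOME c. elemH b 0 0 0 = elemH c 0 0 0)"
  have "elemH b 0 0 0 = elemH c 0 0 0"
    unfolding c_def by (rule someI[of "\<lambda>c. elemH b 0 0 0 = elemH c 0 0 0" b]) simp
  then have "c mod 3 = b mod 3" by (simp add: elemH_eq_iff)
  then show ?thesis unfolding char_H_def c_def[symmetric] by (rule powi_mod_3[OF assms])
qed

lemma schur_multiplier_iso:
  assumes p: "group_hom H20 G p" "p ` carrier H20 = carrier G" and ker: "kernel H20 G p = Z\<^sub>1\<^sub>2"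
  shows "integer_mod_group 3 \<cong> schur_multiplier G"
proof -
  interpret p: group_hom H20 G p by (rule p(1))
  interpret central_extension H20 G p "inv_into (carrier H20) p"
    by unfold_locales (simp_all add: p(2) inv_into_into f_inv_into_f ker center_H20)
  interpret C: comm_group "cocycles2 G" by (rule p.H.comm_group_cocycles2)
  interpret B: normal "coboundaries2 G" "cocycles2 G" by (rule p.H.coboundaries2_normal)
  interpret M: group "schur_multiplier G"
    unfolding schur_multiplier_def by (rule B.factorgroup_is_group)
  let ?B = "coboundaries2 G"
  define \<omega> where "\<omega> = cis (2 * pi / 3)"
  have pow: "\<omega> ^ k = cis (2 * pi * real k / 3)" for k
    by (simp add: \<omega>_def DeMoivre mult_ac)
  have roots: "bij_betw (\<lambda>k. \<omega> ^ k) {..<3} {\<zeta>. \<zeta> ^ 3 = 1}"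
    using bij_betw_roots_unity[of 3] by (simp add: pow)
  have \<omega>_3: "\<omega> ^ 3 = 1" by (simp add: pow)
  have \<omega>3: "(\<omega> powi k) ^ 3 = 1" for k
    using \<omega>_3 by (metis power_int_1_left power_int_commutes power_int_mult power_int_of_nat mult.commute)
  have \<omega>_mod: "\<omega> powi ((k + l) mod 3) = \<omega> powi k * \<omega> powi l" for k l
  proof -
    have "\<omega> powi ((k + l) mod 3) = \<omega> powi (k + l)" by (rule powi_mod_3[OF \<omega>_3]) simp
    then show ?thesis by (simp add: power_int_add \<omega>_def)
  qed
  have char: "kernel_char (char_H \<zeta>)" if "\<zeta> ^ 3 = 1" for \<zeta>
  proof -
    have "\<zeta> \<noteq> 0" using that by auto
    then show ?thesis
      using that unfolding kernel_char_def ker Z12_eq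
      by (auto simp: char_H_elemH elemH_calc power_int_add)
  qed
  \<comment> \<open>The isomorphism maps \<open>k\<close> to the class of the transgression of the character with
    \<open>z\<^sub>1\<^sub>2 \<mapsto> \<omega>\<^sup>k\<close>.\<close>
  define F where "F k = ?B #>\<^bsub>cocycles2 G\<^esub> transgress (char_H (\<omega> powi k))" for k
  have tc: "transgress (char_H (\<omega> powi k)) \<in> carrier (cocycles2 G)" for k
    by (rule transgress_cocycle[OF char[OF \<omega>3]])
  have "F \<in> hom (integer_mod_group 3) (schur_multiplier G)"
  proof (rule homI)
    show "F k \<in> carrier (schur_multiplier G)" for k
      by (auto simp: F_def schur_multiplier_def carrier_FactGroup tc)
    show "F (k \<otimes>\<^bsub>integer_mod_group 3\<^esub> l) = F k \<otimes>\<^bsub>schur_multiplier G\<^esub> F l"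
      if "k \<in> carrier (integer_mod_group 3)" "l \<in> carrier (integer_mod_group 3)" for k l
    proof -
      have "transgress (char_H (\<omega> powi ((k + l) mod 3))) =
          transgress (char_H (\<omega> powi k)) \<otimes>\<^bsub>cocycles2 G\<^esub> transgress (char_H (\<omega> powi l))"
        unfolding \<omega>_mod
      proof (rule transgress_mult)
        fix a assume "a \<in> kernel H20 G p"
        then obtain b where "a = elemH b 0 0 0" unfolding ker Z12_eq by blast
        then show "char_H (\<omega> powi k * \<omega> powi l) a = char_H (\<omega> powi k) a * char_H (\<omega> powi l) a"
          by (simp add: char_H_elemH power_mult_distrib \<omega>3 power_int_mult_distrib)
      qed
      then show ?thesis
        by (simp add: F_def schur_multiplier_def B.rcos_sum tc)
    qed
  qed
  then interpret F: group_hom "integer_mod_group 3" "schur_multiplier G" F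
    by (intro group_hom.intro group_hom_axioms.intro group_integer_mod_group M.is_group)
  have "kernel (integer_mod_group 3) (schur_multiplier G) F = {\<one>\<^bsub>integer_mod_group 3\<^esub>}"
  proof (intro equalityI subsetI)
    fix k assume "k \<in> kernel (integer_mod_group 3) (schur_multiplier G) F"
    then have k: "k \<in> {0..<3}" and "F k = ?B"
      by (auto simp: kernel_def carrier_integer_mod_group schur_multiplier_def)
    then have "transgress (char_H (\<omega> powi k)) \<in> ?B"
      using C.coset_join1[OF _ tc B.subgroup_axioms] by (simp add: F_def)
    then have "char_H (\<omega> powi k) (\<xi>\<^sub>1 \<otimes>\<^bsub>H20\<^esub> \<xi>\<^sub>2 \<otimes>\<^bsub>H20\<^esub> inv\<^bsub>H20\<^esub> \<xi>\<^sub>1 \<otimes>\<^bsub>H20\<^esub> inv\<^bsub>H20\<^esub> \<xi>\<^sub>2) = 1"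
    proof (rule transgress_coboundary_imp_trivial[OF char[OF \<omega>3]])
      have "z\<^sub>1\<^sub>2 \<in> kernel H20 G p" unfolding ker by (auto simp: Z12_eq elemH_gens)
      then have z: "p z\<^sub>1\<^sub>2 = \<one>\<^bsub>G\<^esub>" by (simp add: kernel_def)
      have "p (\<xi>\<^sub>1 \<otimes>\<^bsub>H20\<^esub> \<xi>\<^sub>2) = p (z\<^sub>1\<^sub>2 \<otimes>\<^bsub>H20\<^esub> (\<xi>\<^sub>2 \<otimes>\<^bsub>H20\<^esub> \<xi>\<^sub>1))"
        by (rule arg_cong[of _ _ p]) (simp add: elemH_gens elemH_calc)
      then show "p \<xi>\<^sub>1 \<otimes>\<^bsub>G\<^esub> p \<xi>\<^sub>2 = p \<xi>\<^sub>2 \<otimes>\<^bsub>G\<^esub> p \<xi>\<^sub>1" by (simp add: z)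
    qed simp_all
    then have "\<omega> powi k = 1"
      using char_H_elemH[OF \<omega>3, of k 1] unfolding commutator_xi[symmetric] by (simp add: elemH_gens)
    then have "\<omega> ^ nat k = \<omega> ^ 0" using k by (simp add: power_int_def)
    then have "nat k = 0"
      using k by (intro inj_onD[OF bij_betw_imp_inj_on[OF roots]]) auto
    then show "k \<in> {\<one>\<^bsub>integer_mod_group 3\<^esub>}" using k by simp
  qed (use F.hom_one in \<open>auto simp: kernel_def\<close>)
  moreover have "F ` carrier (integer_mod_group 3) = carrier (schur_multiplier G)"
  proof (intro equalityI subsetI)
    fix Q assume "Q \<in> carrier (schur_multiplier G)"
    then obtain f where f: "f \<in> carrier (cocycles2 G)" "Q = ?B #>\<^bsub>cocycles2 G\<^esub> f"
      by (auto simp: schur_multiplier_def carrier_FactGroup)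
    have z: "elemH (int n) 0 0 0 \<in> kernel H20 G p" for n unfolding ker Z12_eq by simp
    then have "p z\<^sub>1\<^sub>2 = \<one>\<^bsub>G\<^esub>" using z[of 1] by (simp add: kernel_def elemH_gens)
    from H20_hom_to_cocycle_extension[OF p(1) f(1) this]
    obtain \<phi> where "group_hom H20 (cocycle_extension G f) \<phi>"
      "\<And>h. h \<in> carrier H20 \<Longrightarrow> snd (\<phi> h) = p h" by metis
    from cocycle_cohomologous_transgress[OF f(1) this]
    obtain \<chi> g where \<chi>: "kernel_char \<chi>" and g: "g \<in> ?B" "f = g \<otimes>\<^bsub>cocycles2 G\<^esub> transgress \<chi>" by metis
    define \<zeta> where "\<zeta> = \<chi> (elemH 1 0 0 0)"
    have \<chi>_mult: "\<chi> (elemH (int (m + n)) 0 0 0) = \<chi> (elemH (int m) 0 0 0) * \<chi> (elemH (int n) 0 0 0)" for m n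
    proof -
      have "\<chi> (elemH (int m) 0 0 0 \<otimes>\<^bsub>H20\<^esub> elemH (int n) 0 0 0) =
          \<chi> (elemH (int m) 0 0 0) * \<chi> (elemH (int n) 0 0 0)"
        using \<chi> z[of m] z[of n] unfolding kernel_char_def by blast
      then show ?thesis by (simp add: elemH_mult_0)
    qed
    have "\<chi> (elemH 0 0 0 0) \<noteq> 0" using \<chi> z[of 0] by (simp add: kernel_char_def)
    then have \<chi>0: "\<chi> (elemH 0 0 0 0) = 1" using \<chi>_mult[of 0 0] by simp
    have \<chi>n: "\<chi> (elemH (int n) 0 0 0) = \<zeta> ^ n" for n
    proof (induction n)
      case (Suc n)
      then show ?case using \<chi>_mult[of 1 n] by (simp add: \<zeta>_def)
    qed (simp add: \<chi>0)
    have "elemH (int 3) 0 0 0 = elemH 0 0 0 0" by (simp add: elemH_eq_iff)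
    with \<chi>n[of 3] have \<zeta>3: "\<zeta> ^ 3 = 1" by (simp add: \<chi>0)
    then obtain k where k: "k < 3" "\<zeta> = \<omega> ^ k"
      using bij_betw_imp_surj_on[OF roots] by blast
    have "\<chi> a = char_H \<zeta> a" if a: "a \<in> kernel H20 G p" for a
    proof -
      obtain b where "a = elemH b 0 0 0" using a unfolding ker Z12_eq by blast
      then have a: "a = elemH (int (nat (b mod 3))) 0 0 0" by (simp add: elemH_eq_iff)
      show ?thesis unfolding a \<chi>n char_H_elemH[OF \<zeta>3] by (simp only: power_int_of_nat)
    qed
    then have "transgress \<chi> = transgress (char_H \<zeta>)"
      by (auto simp: transgress_def factor_kernel)
    then have "f \<in> ?B #>\<^bsub>cocycles2 G\<^esub> transgress (char_H \<zeta>)"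
      using g by (auto simp: r_coset_def)
    then have "Q = F (int k)"
      using C.repr_independence[OF _ _ B.subgroup_axioms, of f "transgress (char_H \<zeta>)"] tc[of "int k"]
      by (simp add: F_def k(2) f(2))
    then show "Q \<in> F ` carrier (integer_mod_group 3)"
      using k(1) by (intro image_eqI[of _ _ "int k"]) (auto simp: carrier_integer_mod_group)
  qed auto
  ultimately have "F \<in> iso (integer_mod_group 3) (schur_multiplier G)"
    by (simp add: iso_iff F.inj_iff_trivial_ker)
  then show ?thesis by (rule is_isoI)
qed

theorem theorem4p5:
  shows "G20 \<cong> SmallGroup_18_4
    \<and> Z\<^sub>1\<^sub>2 = center H20
    \<and> H20\<lparr>carrier := Z\<^sub>1\<^sub>2\<rparr> \<cong> schur_multiplier G20
    \<and> schur_multiplier G20 \<cong> H20\<lparr>carrier := center H20\<rparr>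
    \<and> center H20 \<subseteq> center H20 \<inter> derived H20 (carrier H20)
    \<and> H20 Mod center H20 \<cong> G20
    \<and> representation_group H20 G20
    \<and> (\<exists>A B. internal_direct H20 \<Xi>\<^sub>1 Z\<^sub>1\<^sub>2 A
           \<and> internal_semidirect H20 A \<Xi>\<^sub>2 B
           \<and> internal_semidirect H20 B W\<^sub>H (carrier H20))
    \<and> H20\<lparr>carrier := \<Xi>\<^sub>1\<rparr> \<cong> integer_mod_group 3
    \<and> H20\<lparr>carrier := Z\<^sub>1\<^sub>2\<rparr> \<cong> integer_mod_group 3
    \<and> H20\<lparr>carrier := \<Xi>\<^sub>2\<rparr> \<cong> integer_mod_group 3
    \<and> H20\<lparr>carrier := W\<^sub>H\<rparr> \<cong> integer_mod_group 2
    \<and> (\<exists>\<phi> \<in> hom (integer_mod_group 3)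
                 (AutoGroup (integer_mod_group 3 \<times>\<times> integer_mod_group 3)).
        let N = semidirect_product (integer_mod_group 3 \<times>\<times> integer_mod_group 3)
                  (integer_mod_group 3) \<phi>
        in \<exists>\<psi> \<in> hom (integer_mod_group 2) (AutoGroup N).
             H20 \<cong> semidirect_product N (integer_mod_group 2) \<psi>)
    \<and> (H20 \<cong> SmallGroup_54_5 \<or> H20 \<cong> SmallGroup_54_8)"
proof -
  have H: "group H20" by (rule H.is_group)
  obtain p where p: "group_hom H20 G20 p" "kernel H20 G20 p = Z\<^sub>1\<^sub>2" "p ` carrier H20 = carrier G20"
    by (rule hom_G20)
  obtain q where q: "group_hom H20 SmallGroup_18_4 q" "kernel H20 SmallGroup_18_4 q = Z\<^sub>1\<^sub>2"
    "q ` carrier H20 = carrier SmallGroup_18_4"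
    by (rule hom_SmallGroup_18_4)
  have quot: "H20 Mod Z\<^sub>1\<^sub>2 \<cong> G20"
    using group_hom.FactGroup_iso_set[OF p(1,3)] unfolding p(2) by (rule is_isoI)
  have quot': "H20 Mod Z\<^sub>1\<^sub>2 \<cong> SmallGroup_18_4"
    using group_hom.FactGroup_iso_set[OF q(1,3)] unfolding q(2) by (rule is_isoI)
  have G20_18: "G20 \<cong> SmallGroup_18_4"
    by (rule iso_trans[OF group.iso_sym[OF normal.factorgroup_is_group[OF Z12_normal] quot] quot'])
  have M: "H20\<lparr>carrier := Z\<^sub>1\<^sub>2\<rparr> \<cong> schur_multiplier G20"
    by (rule iso_trans[OF cyclic_factors(2) schur_multiplier_iso[OF p(1,3,2)]])
  have M': "schur_multiplier G20 \<cong> H20\<lparr>carrier := Z\<^sub>1\<^sub>2\<rparr>"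
    by (rule group.iso_sym[OF H.subgroup_imp_group[OF subgroups_H20(1)] M])
  have "representation_group H20 G20"
    unfolding representation_group_def center_H20
    using H subgroups_H20(1) Z12_derived M quot by blast
  moreover have "\<exists>A B. internal_direct H20 \<Xi>\<^sub>1 Z\<^sub>1\<^sub>2 A
           \<and> internal_semidirect H20 A \<Xi>\<^sub>2 B
           \<and> internal_semidirect H20 B W\<^sub>H (carrier H20)"
    using N1_direct N2_semidirect H20_semidirect by blast
  ultimately show ?thesis
    using G20_18 M M' quot Z12_derived cyclic_factors H20_external H20_iso_SmallGroup_54_8
    unfolding center_H20 by blast
qed

end
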